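(* Suppose that $\theta$ is a large enough regular cardinal, that $(X,\tau)\in H(\theta)$ is a Rothberger space, and that $\mathbb{P}\in H(\theta)$ is a poset. Suppose further that the set of countable $M\prec H(\theta)$ such that $\mathbb{P}$ is strongly proper for $M$ is stationary in $[H(\theta)]^{\aleph_0}$. Then $\mathbb{P}$ forces that $(X,\tau)$ is Rothberger.
   Context: $H(\theta)$ is the collection of sets hereditarily of cardinality $<\theta$; "large enough" has its usual meaning ($\theta\ge\omega_2$ and $H(\theta)$ contains all relevant objects, such as power sets, topologies, and names built from $\mathbb{P}$ and $X$). Strong properness. Let $M\prec H(\theta)$ be countable with $\mathbb{P}\in M$. For $q\in\mathbb{P}$, a condition $\bar q\in M\cap\mathbb{P}$ is a residue of $q$ to $M$ if every $s\le\bar q$ with $s\in M$ is compatible with $q$. A condition $p\in\mathbb{P}$ is $(M,\mathbb{P})$-strongly generic if every $q\le p$ has a residue to $M$. $\mathbb{P}$ is strongly proper for $M$ if every $s\in M\cap\mathbb{P}$ can be extended to an $(M,\mathbb{P})$-strongly generic condition. Preservation. If $G$ is $V$-generic over $\mathbb{P}$, then $\tau^G$ denotes the topology on $X$ in $V[G]$ having $\tau$ as a basis. "$\mathbb{P}$ forces that $(X,\tau)$ has property $\Phi$" means that every condition forces that $(X,\tau^{\dot G})$ has property $\Phi$. A space $X$ is Rothberger if for every sequence $\langle\mathcal{U}_n:n\in\omega\rangle$ of open covers of $X$ there are $U_n\in\mathcal{U}_n$ such that $X=\bigcup_n U_n$. *)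

theory Defs
  imports "HOL-Analysis.Abstract_Topology" "HOL-Library.Countable_Set"
begin

unbundle cardinal_syntax

section \<open>The universe of sets\<close>

text \<open>
  The ambient universe $V$ is a type whose elements are sets. The axioms are those of ZFC, with
  separation and replacement for arbitrary HOL predicates and functions (choice comes from HOL),
  except that the power set axiom is left out. Every universe with power sets is an instance; the
  power sets that matter are demanded explicitly by \<open>large_enough\<close> below. Without the power set
  axiom the class also has small instances such as $H(\lambda)$ for regular uncountable $\lambda$,
  so that no inaccessible cardinal is needed for a type of this class.
\<close>

class set_universe =
  fixes elts :: "'a \<Rightarrow> 'a set"
  assumes extensionality: "elts x = elts y \<Longrightarrow> x = y"
    and foundation: "wf {(x, y). x \<in> elts y}"
    and pairing: "\<exists>z. elts z = {x, y}"
    and union: "\<exists>z. elts z = \<Union> (elts ` elts x)"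
    and separation: "\<exists>z. elts z = {y \<in> elts x. P y}"
    and replacement: "\<exists>z. elts z = f ` elts x"
    and infinity: "\<exists>z. infinite (elts z)"

text \<open>Only meaningful if the members of \<open>A\<close> do form a set of the universe.\<close>

definition vset :: "'v::set_universe set \<Rightarrow> 'v" where
  "vset A = (THE x. elts x = A)"

definition pair :: "'v::set_universe \<Rightarrow> 'v \<Rightarrow> 'v" where
  "pair x y = vset {vset {x}, vset {x, y}}"

primrec ord_of_nat :: "nat \<Rightarrow> 'v::set_universe" where
  "ord_of_nat 0 = vset {}"
| "ord_of_nat (Suc n) = vset (insert (ord_of_nat n) (elts (ord_of_nat n)))"

definition omega :: "'v::set_universe" where
  "omega = vset (range ord_of_nat)"

definition trcl :: "'v::set_universe \<Rightarrow> 'v set" where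
  "trcl x = {y. (y, x) \<in> {(a, b). a \<in> elts b}\<^sup>+}"

definition H :: "'k rel \<Rightarrow> 'v::set_universe set" where
  "H \<theta> = {x. |trcl x| <o \<theta>}"


section \<open>Formulas of set theory and elementary submodels\<close>

text \<open>Variables are natural numbers.\<close>

datatype fm = Mem nat nat | Eq nat nat | Neg fm | Conj fm fm | All nat fm

definition Imp :: "fm \<Rightarrow> fm \<Rightarrow> fm" where "Imp \<phi> \<psi> = Neg (Conj \<phi> (Neg \<psi>))"
definition Disj :: "fm \<Rightarrow> fm \<Rightarrow> fm" where "Disj \<phi> \<psi> = Neg (Conj (Neg \<phi>) (Neg \<psi>))"
definition Iff :: "fm \<Rightarrow> fm \<Rightarrow> fm" where "Iff \<phi> \<psi> = Conj (Imp \<phi> \<psi>) (Imp \<psi> \<phi>)"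
definition Ex :: "nat \<Rightarrow> fm \<Rightarrow> fm" where "Ex i \<phi> = Neg (All i (Neg \<phi>))"
definition BAll :: "nat \<Rightarrow> nat \<Rightarrow> fm \<Rightarrow> fm" where "BAll i j \<phi> = All i (Imp (Mem i j) \<phi>)"
definition BEx :: "nat \<Rightarrow> nat \<Rightarrow> fm \<Rightarrow> fm" where "BEx i j \<phi> = Ex i (Conj (Mem i j) \<phi>)"

primrec sat :: "'v::set_universe set \<Rightarrow> fm \<Rightarrow> (nat \<Rightarrow> 'v) \<Rightarrow> bool" where
  "sat M (Mem i j) e \<longleftrightarrow> e i \<in> elts (e j)"
| "sat M (Eq i j) e \<longleftrightarrow> e i = e j"
| "sat M (Neg \<phi>) e \<longleftrightarrow> \<not> sat M \<phi> e"
| "sat M (Conj \<phi> \<psi>) e \<longleftrightarrow> sat M \<phi> e \<and> sat M \<psi> e"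
| "sat M (All i \<phi>) e \<longleftrightarrow> (\<forall>x\<in>M. sat M \<phi> (e(i := x)))"

definition elementary_submodel :: "'v::set_universe set \<Rightarrow> 'v set \<Rightarrow> bool" where
  "elementary_submodel M N \<longleftrightarrow>
     M \<noteq> {} \<and> M \<subseteq> N \<and> (\<forall>\<phi> e. range e \<subseteq> M \<longrightarrow> (sat M \<phi> e \<longleftrightarrow> sat N \<phi> e))"


section \<open>Stationary sets of countable sets\<close>

definition ctbl_subsets :: "'a set \<Rightarrow> 'a set set" where
  "ctbl_subsets A = {x. x \<subseteq> A \<and> countable x \<and> infinite x}"

definition club :: "'a set \<Rightarrow> 'a set set \<Rightarrow> bool" where
  "club A C \<longleftrightarrow> C \<subseteq> ctbl_subsets A \<and>
     (\<forall>x\<in>ctbl_subsets A. \<exists>y\<in>C. x \<subseteq> y) \<and>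
     (\<forall>f :: nat \<Rightarrow> 'a set. incseq f \<and> range f \<subseteq> C \<longrightarrow> (\<Union>n. f n) \<in> C)"

definition stationary :: "'a set \<Rightarrow> 'a set set \<Rightarrow> bool" where
  "stationary A S \<longleftrightarrow> S \<subseteq> ctbl_subsets A \<and> (\<forall>C. club A C \<longrightarrow> S \<inter> C \<noteq> {})"


section \<open>Spaces\<close>

definition rothberger :: "'a topology \<Rightarrow> bool" where
  "rothberger T \<longleftrightarrow>
     (\<forall>\<U> :: nat \<Rightarrow> 'a set set.
        (\<forall>n. (\<forall>U\<in>\<U> n. openin T U) \<and> \<Union> (\<U> n) = topspace T) \<longrightarrow>
        (\<exists>U. (\<forall>n. U n \<in> \<U> n) \<and> topspace T = (\<Union>n. U n)))"

definition is_space :: "'v::set_universe \<Rightarrow> 'v \<Rightarrow> bool" where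
  "is_space X \<tau> \<longleftrightarrow> istopology (\<lambda>U. U \<in> elts ` elts \<tau>) \<and> \<Union> (elts ` elts \<tau>) = elts X"

definition topology_of :: "'v::set_universe \<Rightarrow> 'v topology" where
  "topology_of \<tau> = topology (\<lambda>U. U \<in> elts ` elts \<tau>)"


section \<open>Posets and strong properness\<close>

definition cle :: "'v::set_universe \<Rightarrow> 'v \<Rightarrow> 'v \<Rightarrow> bool" where
  "cle le p q \<longleftrightarrow> pair p q \<in> elts le"

text \<open>As usual in forcing, antisymmetry is not required; partial orders are a special case.\<close>

definition is_poset :: "'v::set_universe \<Rightarrow> 'v \<Rightarrow> bool" where
  "is_poset P le \<longleftrightarrow>
     elts le \<subseteq> {pair p q | p q. p \<in> elts P \<and> q \<in> elts P} \<and>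
     preorder_on (elts P) {(p, q). cle le p q}"

definition compat :: "'v::set_universe \<Rightarrow> 'v \<Rightarrow> 'v \<Rightarrow> 'v \<Rightarrow> bool" where
  "compat P le p q \<longleftrightarrow> (\<exists>r\<in>elts P. cle le r p \<and> cle le r q)"

definition residue :: "'v::set_universe \<Rightarrow> 'v \<Rightarrow> 'v set \<Rightarrow> 'v \<Rightarrow> 'v \<Rightarrow> bool" where
  "residue P le M q r \<longleftrightarrow>
     r \<in> M \<inter> elts P \<and> (\<forall>s \<in> M \<inter> elts P. cle le s r \<longrightarrow> compat P le s q)"

definition strongly_generic :: "'v::set_universe \<Rightarrow> 'v \<Rightarrow> 'v set \<Rightarrow> 'v \<Rightarrow> bool" where
  "strongly_generic P le M p \<longleftrightarrow>
     p \<in> elts P \<and> (\<forall>q\<in>elts P. cle le q p \<longrightarrow> (\<exists>r. residue P le M q r))"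

definition strongly_proper_for :: "'v::set_universe \<Rightarrow> 'v \<Rightarrow> 'v set \<Rightarrow> bool" where
  "strongly_proper_for P le M \<longleftrightarrow>
     (\<forall>s \<in> M \<inter> elts P. \<exists>p. cle le p s \<and> strongly_generic P le M p)"


section \<open>Names and the forcing relation\<close>

inductive_set names :: "'v::set_universe \<Rightarrow> 'v set" for P where
  "(\<And>z. z \<in> elts x \<Longrightarrow> \<exists>y p. y \<in> names P \<and> p \<in> elts P \<and> z = pair y p) \<Longrightarrow> x \<in> names P"

text \<open>
  The poset need not have a largest element, so the canonical name of \<open>x\<close> carries every condition.
\<close>

function check :: "'v::set_universe \<Rightarrow> 'v \<Rightarrow> 'v" where
  "check P x = vset {pair c p | c p. c \<in> check P ` elts x \<and> p \<in> elts P}"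
  by auto
termination
  by (relation "inv_image {(x, y). x \<in> elts y} snd") (auto simp: wf_inv_image foundation)

declare check.simps [simp del]

definition dense_below :: "'v::set_universe \<Rightarrow> 'v \<Rightarrow> 'v \<Rightarrow> ('v \<Rightarrow> bool) \<Rightarrow> bool" where
  "dense_below P le p D \<longleftrightarrow>
     (\<forall>q\<in>elts P. cle le q p \<longrightarrow> (\<exists>r\<in>elts P. cle le r q \<and> D r))"

lemma dense_below_mono [mono]:
  "(\<And>r. D r \<longrightarrow> D' r) \<Longrightarrow> dense_below P le p D \<longrightarrow> dense_below P le p D'"
  unfolding dense_below_def by blast

text \<open>
  The usual recursion for $p \Vdash a = b$. The recursive calls are positive and concern names of
  lower rank on both sides, so the inductive predicate is the unique solution of the recursion.
\<close>

inductive forces_eq :: "'v::set_universe \<Rightarrow> 'v \<Rightarrow> 'v \<Rightarrow> 'v \<Rightarrow> 'v \<Rightarrow> bool" for P le where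
  "\<lbrakk>\<forall>c s. pair c s \<in> elts a \<longrightarrow>
      dense_below P le p (\<lambda>q. cle le q s \<longrightarrow>
        (\<exists>d t. pair d t \<in> elts b \<and> cle le q t \<and> forces_eq P le q c d));
    \<forall>d t. pair d t \<in> elts b \<longrightarrow>
      dense_below P le p (\<lambda>q. cle le q t \<longrightarrow>
        (\<exists>c s. pair c s \<in> elts a \<and> cle le q s \<and> forces_eq P le q c d))\<rbrakk>
   \<Longrightarrow> forces_eq P le p a b"

definition forces_mem :: "'v::set_universe \<Rightarrow> 'v \<Rightarrow> 'v \<Rightarrow> 'v \<Rightarrow> 'v \<Rightarrow> bool" where
  "forces_mem P le p a b \<longleftrightarrow>
     dense_below P le p (\<lambda>q. \<exists>c s. pair c s \<in> elts b \<and> cle le q s \<and> forces_eq P le q a c)"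

text \<open>
  \<open>forces P le \<phi> e p\<close>: the condition \<open>p\<close> forces \<open>\<phi>\<close>, where \<open>e\<close> assigns names to the
  free variables.
\<close>

primrec forces ::
  "'v::set_universe \<Rightarrow> 'v \<Rightarrow> fm \<Rightarrow> (nat \<Rightarrow> 'v) \<Rightarrow> 'v \<Rightarrow> bool" where
  "forces P le (Mem i j) e p \<longleftrightarrow> forces_mem P le p (e i) (e j)"
| "forces P le (Eq i j) e p \<longleftrightarrow> forces_eq P le p (e i) (e j)"
| "forces P le (Neg \<phi>) e p \<longleftrightarrow> (\<forall>q\<in>elts P. cle le q p \<longrightarrow> \<not> forces P le \<phi> e q)"
| "forces P le (Conj \<phi> \<psi>) e p \<longleftrightarrow> forces P le \<phi> e p \<and> forces P le \<psi> e p"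
| "forces P le (All i \<phi>) e p \<longleftrightarrow> (\<forall>x\<in>names P. forces P le \<phi> (e(i := x)) p)"


section \<open>The Rothberger property as a formula\<close>

text \<open>
  In the following the arguments are variables. Bound variables are chosen larger than the
  arguments, so that nothing is captured.
\<close>

text \<open>\<open>z = (x, y)\<close>, the Kuratowski pair\<close>

definition pair_fm :: "nat \<Rightarrow> nat \<Rightarrow> nat \<Rightarrow> fm" where
  "pair_fm z x y = (let w = Suc (z + x + y); u = Suc w in
     All w (Iff (Mem w z)
       (Disj (All u (Iff (Mem u w) (Eq u x)))
             (All u (Iff (Mem u w) (Disj (Eq u x) (Eq u y)))))))"

text \<open>\<open>(x, y) \<in> f\<close>\<close>

definition pair_mem_fm :: "nat \<Rightarrow> nat \<Rightarrow> nat \<Rightarrow> fm" where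
  "pair_mem_fm x y f = (let z = Suc (x + y + f) in BEx z f (pair_fm z x y))"

text \<open>\<open>f\<close> is a function with domain \<open>A\<close>\<close>

definition function_fm :: "nat \<Rightarrow> nat \<Rightarrow> fm" where
  "function_fm f A = (let x = Suc (f + A); y = Suc x; z = Suc y in
     Conj (BAll z f (BEx x A (Ex y (pair_fm z x y))))
          (BAll x A (Ex y (All z (Iff (pair_mem_fm x z f) (Eq z y))))))"

text \<open>\<open>U\<close> is open in the topology on \<open>X\<close> having \<open>T\<close> as a basis\<close>

definition open_fm :: "nat \<Rightarrow> nat \<Rightarrow> nat \<Rightarrow> fm" where
  "open_fm U X T = (let x = Suc (U + X + T); B = Suc x; y = Suc B in
     BAll x U (Conj (Mem x X) (BEx B T (Conj (Mem x B) (BAll y B (Mem y U))))))"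

text \<open>\<open>C\<close> is an open cover of \<open>X\<close> in that topology\<close>

definition open_cover_fm :: "nat \<Rightarrow> nat \<Rightarrow> nat \<Rightarrow> fm" where
  "open_cover_fm C X T = (let U = Suc (C + X + T); x = Suc U in
     Conj (BAll U C (open_fm U X T)) (BAll x X (BEx U C (Mem x U))))"

text \<open>
  The topology on \<open>X\<close> having \<open>T\<close> as a basis is Rothberger; \<open>N\<close> stands for $\omega$. The
  sequences of covers and of selected sets are functions \<open>f\<close> and \<open>g\<close> with domain \<open>N\<close>.
\<close>

definition rothberger_fm :: "nat \<Rightarrow> nat \<Rightarrow> nat \<Rightarrow> fm" where
  "rothberger_fm X T N =
    (let f = Suc (X + T + N); g = Suc f; n = Suc g; C = Suc n; U = Suc C; x = Suc U in
     All f (Imp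
       (Conj (function_fm f N)
             (All n (All C (Imp (pair_mem_fm n C f) (open_cover_fm C X T)))))
       (Ex g (Conj (function_fm g N)
         (Conj
           (All n (All C (All U (Imp (Conj (pair_mem_fm n C f) (pair_mem_fm n U g)) (Mem U C)))))
           (All x (Iff (Mem x X) (BEx n N (Ex U (Conj (pair_mem_fm n U g) (Mem x U)))))))))))"

text \<open>The canonical names of \<open>X\<close>, \<open>\<tau>\<close> and $\omega$ are substituted for variables 0, 1 and 2.\<close>

definition forces_rothberger :: "'v::set_universe \<Rightarrow> 'v \<Rightarrow> 'v \<Rightarrow> 'v \<Rightarrow> bool" where
  "forces_rothberger P le X \<tau> \<longleftrightarrow>
     (\<forall>p\<in>elts P. forces P le (rothberger_fm 0 1 2)
        ((\<lambda>_. check P omega)(0 := check P X, 1 := check P \<tau>)) p)"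


section \<open>Large enough cardinals\<close>

definition nice_names :: "'v::set_universe \<Rightarrow> 'v set \<Rightarrow> 'v set" where
  "nice_names P A = {\<nu>. elts \<nu> \<subseteq> {pair (check P z) p | z p. z \<in> A \<and> p \<in> elts P}}"

text \<open>
  Besides $\theta \ge \omega_2$: $H(\theta)$ is a set of the universe and has as elements the power
  sets of \<open>X\<close>, \<open>\<tau>\<close> and \<open>P\<close>, the double power set of \<open>X\<close> (to which all topologies on \<open>X\<close> belong),
  and the sets of nice names for subsets of \<open>X\<close> and of $\omega \times \tau$ (the latter code
  sequences of families of basic open sets).
\<close>

definition large_enough :: "'k rel \<Rightarrow> 'v::set_universe \<Rightarrow> 'v \<Rightarrow> 'v \<Rightarrow> bool" where
  "large_enough \<theta> X \<tau> P \<longleftrightarrow>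
     cardSuc (cardSuc natLeq) \<le>o \<theta> \<and>
     (H \<theta> :: 'v set) \<in> range elts \<and>
     {{A. elts A \<subseteq> elts X},
      {A. elts A \<subseteq> elts \<tau>},
      {A. elts A \<subseteq> elts P},
      {S. \<forall>A\<in>elts S. elts A \<subseteq> elts X},
      nice_names P (elts X),
      nice_names P {pair n U | n U. n \<in> elts omega \<and> U \<in> elts \<tau>}} \<subseteq> elts ` H \<theta>"

end

theory Submission
  imports Defs
begin

text \<open>
  Let \<open>f\<close> name a sequence of covers. For a condition \<open>r\<close>, the basic open sets that some
  \<open>s \<le> r\<close> forces to lie inside a member of the \<open>n\<close>-th cover form a cover in the ground model, so the
  Rothberger property gives a selection for each \<open>r\<close> and each infinite set of indices. Take a countable
  model \<open>M\<close> that contains witnessing conditions \<open>s\<close> for its own conditions \<open>r\<close>, reserve an infinite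
  set of indices for each of them, and let \<open>B\<close> combine the selections. If \<open>q\<close> is below a strongly
  generic condition and \<open>x\<close> is a point, a residue \<open>r\<close> of \<open>q\<close> has a selected set \<open>B n\<close> containing
  \<open>x\<close>, and its witness \<open>s\<close> in \<open>M\<close> is compatible with \<open>q\<close>; so densely often \<open>x\<close> is covered by the
  member of the \<open>n\<close>-th cover around \<open>B n\<close>. Of \<open>M\<close> only closure under countably many functions is
  needed, which a stationary set provides for arbitrary functions, definable or not.
\<close>

section \<open>Sets of the universe\<close>

definition small :: "'v::set_universe set \<Rightarrow> bool" where
  "small A \<longleftrightarrow> A \<in> range elts"

lemma small_elts [simp]: "small (elts x)"
  by (simp add: small_def)

lemma elts_vset [simp]:
  assumes "small A"
  shows "elts (vset A) = A"
proof -
  obtain z where z: "elts z = A"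
    using assms by (auto simp: small_def)
  have "vset A = z"
    unfolding vset_def by (rule the_equality) (auto simp: z intro: extensionality)
  then show ?thesis
    using z by simp
qed

lemma small_subset: "small A \<Longrightarrow> B \<subseteq> A \<Longrightarrow> small B"
proof -
  assume "small A" "B \<subseteq> A"
  then obtain x where x: "elts x = A"
    by (auto simp: small_def)
  obtain z where "elts z = {y \<in> elts x. y \<in> B}"
    using separation[of x "\<lambda>y. y \<in> B"] by blast
  then have "elts z = B"
    using x \<open>B \<subseteq> A\<close> by auto
  then show "small B"
    using small_elts[of z] by simp
qed

lemma small_image:
  fixes f :: "'v::set_universe \<Rightarrow> 'v"
  shows "small A \<Longrightarrow> small (f ` A)"
proof -
  assume "small A"
  then obtain x where x: "A = elts x"
    by (auto simp: small_def)
  obtain z where "elts z = f ` elts x"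
    using replacement[of f x] by blast
  then show "small (f ` A)"
    using small_elts[of z] by (simp add: x)
qed

lemma small_doubleton [simp]: "small {x, y}"
proof -
  obtain z where "elts z = {x, y}"
    using pairing[of x y] by blast
  then show ?thesis
    using small_elts[of z] by simp
qed

lemma small_singleton [simp]: "small {x}"
  using small_doubleton[of x x] by simp

text \<open>Replacement applies to functions with values in the universe, so the family is first
  coded by \<open>vset\<close>; the union axiom does the rest.\<close>

lemma small_UN:
  fixes F :: "'v::set_universe \<Rightarrow> 'v set"
  assumes "small A" and "\<And>a. a \<in> A \<Longrightarrow> small (F a)"
  shows "small (\<Union>a\<in>A. F a)"
proof -
  have "small ((\<lambda>a. vset (F a)) ` A)"
    by (rule small_image) (rule assms(1))
  then obtain z where z: "elts z = (\<lambda>a. vset (F a)) ` A"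
    unfolding small_def by force
  obtain u where "elts u = \<Union> (elts ` elts z)"
    using union[of z] by blast
  also have "\<dots> = (\<Union>a\<in>A. F a)"
    using assms(2) by (auto simp: z)
  finally show ?thesis
    using small_elts[of u] by simp
qed

lemma small_Un: "small A \<Longrightarrow> small B \<Longrightarrow> small (A \<union> B)"
  using small_UN[of "{vset A, vset B}" elts] by simp

lemma small_pairs: "small A \<Longrightarrow> small B \<Longrightarrow> small {pair a b | a b. a \<in> A \<and> b \<in> B}"
proof -
  assume "small A" "small B"
  then have "small (\<Union>a\<in>A. pair a ` B)"
    by (intro small_UN small_image)
  also have "(\<Union>a\<in>A. pair a ` B) = {pair a b | a b. a \<in> A \<and> b \<in> B}"
    by auto
  finally show ?thesis .
qed

lemma pair_eq_iff [simp]: "pair x y = pair a b \<longleftrightarrow> x = a \<and> y = b"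
proof
  assume "pair x y = pair a b"
  then have "elts ` elts (pair x y) = elts ` elts (pair a b)"
    by simp
  then have "{{x}, {x, y}} = {{a}, {a, b}}"
    by (simp add: pair_def)
  then show "x = a \<and> y = b"
    by (auto simp: doubleton_eq_iff)
qed simp

text \<open>The axiom of infinity provides just some infinite set. Inverting an injection of the
  naturals into it makes \<open>range f\<close> part of an image of that set under
  replacement.\<close>

lemma small_range_nat: "small (range (f :: nat \<Rightarrow> 'v::set_universe))"
proof -
  obtain z :: 'v where "infinite (elts z)"
    using infinity by blast
  then obtain h :: "nat \<Rightarrow> 'v" where h: "inj h" "range h \<subseteq> elts z"
    using infinite_countable_subset by blast
  have "range f \<subseteq> (\<lambda>x. f (inv h x)) ` elts z"
  proof
    fix y assume "y \<in> range f"
    then obtain n where "y = f n" by blast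
    then have "y = f (inv h (h n))" by (simp add: h(1))
    then show "y \<in> (\<lambda>x. f (inv h x)) ` elts z"
      using h(2) by blast
  qed
  then show ?thesis
    using small_image[OF small_elts] small_subset by blast
qed

lemma elts_omega [simp]: "elts omega = range ord_of_nat"
  by (simp add: omega_def small_range_nat)

lemma small_ord_of_nat_step: "small (insert x (elts x))"
  using small_Un[OF small_singleton small_elts, of x x] by simp

lemma not_mem_self: "x \<notin> elts (x::'v::set_universe)"
  using wf_not_refl[OF foundation, of x] by simp

lemma small_UN_nat:
  fixes F :: "nat \<Rightarrow> 'v::set_universe set"
  assumes "\<And>n. small (F n)"
  shows "small (\<Union>n. F n)"
proof -
  have "small (\<Union>z\<in>range (\<lambda>n. vset (F n)). elts z)"
    by (intro small_UN small_range_nat small_elts)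
  then show ?thesis
    using assms by simp
qed

lemma inj_ord_of_nat: "inj (ord_of_nat :: nat \<Rightarrow> 'v::set_universe)"
proof (rule linorder_injI)
  fix m n :: nat
  assume "m < n"
  then have "ord_of_nat m \<in> elts (ord_of_nat n :: 'v)"
    by (induction n) (auto simp: small_ord_of_nat_step less_Suc_eq)
  then show "ord_of_nat m \<noteq> (ord_of_nat n :: 'v)"
    using not_mem_self by metis
qed

text \<open>A name \<open>c\<close> lies three membership steps below \<open>a\<close>, through
  \<open>vset {c}\<close> and the pair, so the induction runs along the transitive closure of
  membership. It speaks of all sets, so the equality lemmas hold for arbitrary arguments, names or
  not.\<close>

lemma name_induct [case_names step]:
  assumes "\<And>a. (\<And>c s. pair c s \<in> elts a \<Longrightarrow> Q c) \<Longrightarrow> Q a"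
  shows "Q (a :: 'v::set_universe)"
proof (induction a rule: wf_induct_rule[OF wf_trancl[OF foundation]])
  case (1 a)
  show ?case
  proof (rule assms)
    fix c s assume "pair c s \<in> elts a"
    moreover have "c \<in> elts (vset {c})" "vset {c} \<in> elts (pair c s)"
      by (simp_all add: pair_def)
    ultimately have "(c, a) \<in> {(x, y). x \<in> elts y}\<^sup>+"
      by (metis (mono_tags, lifting) case_prodI mem_Collect_eq trancl.simps)
    then show "Q c"
      by (rule 1)
  qed
qed

lemma elts_check: "elts (check P x) = {pair (check P y) p | y p. y \<in> elts x \<and> p \<in> elts P}"
proof -
  have "elts (check P x) = {pair c p | c p. c \<in> check P ` elts x \<and> p \<in> elts P}"
    by (subst check.simps) (simp add: small_pairs small_image)
  then show ?thesis by blast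
qed

lemma names_check: "check P x \<in> names P"
proof (induction x rule: wf_induct_rule[OF foundation])
  case (1 x)
  show ?case
    by (rule names.intros) (use 1 in \<open>auto simp: elts_check\<close>)
qed

lemma namesD: "x \<in> names P \<Longrightarrow> pair c s \<in> elts x \<Longrightarrow> c \<in> names P \<and> s \<in> elts P"
  by (erule names.cases) force

section \<open>The forcing relation\<close>

locale forcing =
  fixes P le :: "'v::set_universe"
  assumes poset: "is_poset P le"
begin

abbreviation leq (infix "\<preceq>" 50) where "p \<preceq> q \<equiv> cle le p q"
abbreviation feq where "feq \<equiv> forces_eq P le"
abbreviation fmem where "fmem \<equiv> forces_mem P le"
abbreviation dense where "dense \<equiv> dense_below P le"

lemma leq_in: "p \<preceq> q \<Longrightarrow> p \<in> elts P \<and> q \<in> elts P"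
  using poset unfolding is_poset_def cle_def by auto

lemma leq_in1: "p \<preceq> q \<Longrightarrow> p \<in> elts P"
  using leq_in by blast

lemma leq_refl [simp]: "p \<in> elts P \<Longrightarrow> p \<preceq> p"
  using poset unfolding is_poset_def preorder_on_def refl_on_def by auto

lemma leq_trans [trans]: "p \<preceq> q \<Longrightarrow> q \<preceq> r \<Longrightarrow> p \<preceq> r"
  using poset unfolding is_poset_def preorder_on_def trans_def by auto

section \<open>Density below a condition\<close>

lemma denseI: "(\<And>q. q \<preceq> p \<Longrightarrow> \<exists>r. r \<preceq> q \<and> D r) \<Longrightarrow> dense p D"
  unfolding dense_below_def by (meson leq_in1)

lemma denseD: "dense p D \<Longrightarrow> q \<preceq> p \<Longrightarrow> \<exists>r. r \<preceq> q \<and> D r"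
  unfolding dense_below_def using leq_in1 by blast

lemma dense_leq: "dense p D \<Longrightarrow> q \<preceq> p \<Longrightarrow> dense q D"
  unfolding dense_below_def by (blast intro: leq_trans)

lemma dense_always: "(\<And>q. q \<preceq> p \<Longrightarrow> D q) \<Longrightarrow> dense p D"
  unfolding dense_below_def by (blast intro: leq_refl)

text \<open>Going below a condition twice is going below it once. Arguments that pick a witness in
  the extension and then continue with it have this shape.\<close>

lemma dense_bind:
  assumes "dense p D" and D: "\<And>q. q \<preceq> p \<Longrightarrow> D q \<Longrightarrow> dense q D'"
  shows "dense p D'"
proof (rule denseI)
  fix q assume q: "q \<preceq> p"
  then obtain r where r: "r \<preceq> q" "D r"
    using denseD[OF assms(1)] by blast
  then obtain s where "s \<preceq> r" "D' s"
    using denseD[OF D[OF leq_trans[OF r(1) q]]] leq_refl[OF leq_in1[OF r(1)]] by blast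
  then show "\<exists>s. s \<preceq> q \<and> D' s"
    using leq_trans[OF _ r(1)] by blast
qed

lemma dense_idem: "dense p (\<lambda>q. dense q D) \<Longrightarrow> dense p D"
  by (rule dense_bind)

lemma dense_mono:
  assumes "dense p D" and "\<And>q. q \<preceq> p \<Longrightarrow> D q \<Longrightarrow> D' q"
  shows "dense p D'"
proof (rule denseI)
  fix q assume q: "q \<preceq> p"
  then obtain r where "r \<preceq> q" "D r"
    using denseD[OF assms(1)] by blast
  then show "\<exists>r. r \<preceq> q \<and> D' r"
    using assms(2) leq_trans[OF _ q] by blast
qed

lemma dense_cong:
  "(\<And>q. q \<preceq> p \<Longrightarrow> D q \<longleftrightarrow> D' q) \<Longrightarrow> dense p D \<longleftrightarrow> dense p D'"
  using dense_mono[of p D D'] dense_mono[of p D' D] by blast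

text \<open>From right to left, a condition that is not below \<open>s\<close> meets the implication
  vacuously. This brings the clauses of \<open>forces_eq\<close> to the form in which one first goes
  below \<open>s\<close> and only then asks for density.\<close>

lemma dense_imp:
  "dense p (\<lambda>q. q \<preceq> s \<longrightarrow> D q) \<longleftrightarrow> (\<forall>q. q \<preceq> p \<longrightarrow> q \<preceq> s \<longrightarrow> dense q D)"
  (is "?L \<longleftrightarrow> ?R")
proof
  assume L: ?L
  show ?R
  proof (intro allI impI)
    fix q assume q: "q \<preceq> p" "q \<preceq> s"
    show "dense q D"
      by (rule dense_mono[OF dense_leq[OF L q(1)]]) (blast intro: leq_trans[OF _ q(2)])
  qed
next
  assume R: ?R
  show ?L
  proof (rule denseI)
    fix q assume q: "q \<preceq> p"
    show "\<exists>r. r \<preceq> q \<and> (r \<preceq> s \<longrightarrow> D r)"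
    proof (cases "q \<preceq> s")
      case True
      then have "dense q D"
        using R q by blast
      from denseD[OF this leq_refl[OF leq_in1[OF q]]] show ?thesis
        by blast
    next
      case False
      then show ?thesis
        using leq_refl[OF leq_in1[OF q]] by blast
    qed
  qed
qed

section \<open>Forced equality and membership\<close>

lemma feq_iff:
  "feq p a b \<longleftrightarrow>
     (\<forall>c s. pair c s \<in> elts a \<longrightarrow> (\<forall>q. q \<preceq> p \<longrightarrow> q \<preceq> s \<longrightarrow>
        dense q (\<lambda>r. \<exists>d t. pair d t \<in> elts b \<and> r \<preceq> t \<and> feq r c d))) \<and>
     (\<forall>d t. pair d t \<in> elts b \<longrightarrow> (\<forall>q. q \<preceq> p \<longrightarrow> q \<preceq> t \<longrightarrow>
        dense q (\<lambda>r. \<exists>c s. pair c s \<in> elts a \<and> r \<preceq> s \<and> feq r c d)))"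
  by (subst forces_eq.simps) (simp add: dense_imp)

lemma feq_mono: "feq p a b \<Longrightarrow> q \<preceq> p \<Longrightarrow> feq q a b"
  unfolding feq_iff[of _ a b] by (meson leq_trans)

lemma feq_dense:
  assumes "dense p (\<lambda>q. feq q a b)"
  shows "feq p a b"
proof -
  have "dense q (\<lambda>r. \<exists>d t. pair d t \<in> elts b \<and> r \<preceq> t \<and> feq r c d)"
    if c: "pair c s \<in> elts a" and q: "q \<preceq> p" "q \<preceq> s" for c s q
  proof (rule dense_bind[OF dense_leq[OF assms q(1)]])
    fix r assume r: "r \<preceq> q" "feq r a b"
    then show "dense r (\<lambda>r. \<exists>d t. pair d t \<in> elts b \<and> r \<preceq> t \<and> feq r c d)"
      using c leq_trans[OF r(1) q(2)] leq_refl[OF leq_in1[OF r(1)]]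
      unfolding feq_iff[of r a b] by blast
  qed
  moreover have "dense q (\<lambda>r. \<exists>c s. pair c s \<in> elts a \<and> r \<preceq> s \<and> feq r c d)"
    if d: "pair d t \<in> elts b" and q: "q \<preceq> p" "q \<preceq> t" for d t q
  proof (rule dense_bind[OF dense_leq[OF assms q(1)]])
    fix r assume r: "r \<preceq> q" "feq r a b"
    then show "dense r (\<lambda>r. \<exists>c s. pair c s \<in> elts a \<and> r \<preceq> s \<and> feq r c d)"
      using d leq_trans[OF r(1) q(2)] leq_refl[OF leq_in1[OF r(1)]]
      unfolding feq_iff[of r a b] by blast
  qed
  ultimately show ?thesis
    unfolding feq_iff[of p a b] by blast
qed

lemma feq_refl [simp]: "feq p a a"
proof (induction a arbitrary: p rule: name_induct)
  case (step a)
  have "dense q (\<lambda>r. \<exists>d t. pair d t \<in> elts a \<and> r \<preceq> t \<and> feq r c d)"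
       "dense q (\<lambda>r. \<exists>d t. pair d t \<in> elts a \<and> r \<preceq> t \<and> feq r d c)"
    if "pair c s \<in> elts a" "q \<preceq> s" for c s q
    by (rule dense_always; use that step leq_trans in blast)+
  then show ?case
    unfolding feq_iff[of p a a] by blast
qed

lemma feq_sym: "feq p a b \<Longrightarrow> feq p b a"
proof (induction a arbitrary: p b rule: name_induct)
  case (step a)
  have "dense q (\<lambda>r. \<exists>d t. pair d t \<in> elts b \<and> r \<preceq> t \<and> feq r d c)"
    if c: "pair c s \<in> elts a" and q: "q \<preceq> p" "q \<preceq> s" for c s q
  proof (rule dense_mono)
    show "dense q (\<lambda>r. \<exists>d t. pair d t \<in> elts b \<and> r \<preceq> t \<and> feq r c d)"
      using step.prems c q unfolding feq_iff[of p a b] by blast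
  qed (use step.IH[OF c] in blast)
  moreover have "dense q (\<lambda>r. \<exists>c s. pair c s \<in> elts a \<and> r \<preceq> s \<and> feq r d c)"
    if d: "pair d t \<in> elts b" and q: "q \<preceq> p" "q \<preceq> t" for d t q
  proof (rule dense_mono)
    show "dense q (\<lambda>r. \<exists>c s. pair c s \<in> elts a \<and> r \<preceq> s \<and> feq r c d)"
      using step.prems d q unfolding feq_iff[of p a b] by blast
  qed (use step.IH in blast)
  ultimately show ?case
    unfolding feq_iff[of p b a] by blast
qed

text \<open>An entry of \<open>a\<close> is matched with one of \<open>b\<close> and then with one
  of \<open>c\<close>, and the induction hypothesis composes the two equalities. The second half
  starts from an entry of \<open>c\<close>, yet the induction hypothesis is again used at the entry
  of \<open>a\<close> that is found.\<close>

lemma feq_trans: "feq p a b \<Longrightarrow> feq p b c \<Longrightarrow> feq p a c"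
proof (induction a arbitrary: p b c rule: name_induct)
  case (step a)
  have "dense q (\<lambda>r. \<exists>z u. pair z u \<in> elts c \<and> r \<preceq> u \<and> feq r x z)"
    if x: "pair x s \<in> elts a" and q: "q \<preceq> p" "q \<preceq> s" for x s q
  proof (rule dense_bind)
    show "dense q (\<lambda>r. \<exists>y t. pair y t \<in> elts b \<and> r \<preceq> t \<and> feq r x y)"
      using step.prems(1) x q unfolding feq_iff[of p a b] by blast
    fix r assume r: "r \<preceq> q" "\<exists>y t. pair y t \<in> elts b \<and> r \<preceq> t \<and> feq r x y"
    then obtain y t where y: "pair y t \<in> elts b" "r \<preceq> t" "feq r x y" by blast
    show "dense r (\<lambda>r. \<exists>z u. pair z u \<in> elts c \<and> r \<preceq> u \<and> feq r x z)"
    proof (rule dense_mono)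
      show "dense r (\<lambda>r. \<exists>z u. pair z u \<in> elts c \<and> r \<preceq> u \<and> feq r y z)"
        using step.prems(2) y leq_trans[OF r(1) q(1)] unfolding feq_iff[of p b c] by blast
    qed (use step.IH[OF x] y(3) feq_mono in blast)
  qed
  moreover have "dense q (\<lambda>r. \<exists>x s. pair x s \<in> elts a \<and> r \<preceq> s \<and> feq r x z)"
    if z: "pair z u \<in> elts c" and q: "q \<preceq> p" "q \<preceq> u" for z u q
  proof (rule dense_bind)
    show "dense q (\<lambda>r. \<exists>y t. pair y t \<in> elts b \<and> r \<preceq> t \<and> feq r y z)"
      using step.prems(2) z q unfolding feq_iff[of p b c] by blast
    fix r assume r: "r \<preceq> q" "\<exists>y t. pair y t \<in> elts b \<and> r \<preceq> t \<and> feq r y z"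
    then obtain y t where y: "pair y t \<in> elts b" "r \<preceq> t" "feq r y z" by blast
    show "dense r (\<lambda>r. \<exists>x s. pair x s \<in> elts a \<and> r \<preceq> s \<and> feq r x z)"
    proof (rule dense_mono)
      show "dense r (\<lambda>r. \<exists>x s. pair x s \<in> elts a \<and> r \<preceq> s \<and> feq r x y)"
        using step.prems(1) y leq_trans[OF r(1) q(1)] unfolding feq_iff[of p a b] by blast
    qed (use step.IH y(3) feq_mono in blast)
  qed
  ultimately show ?case
    unfolding feq_iff[of p a c] by blast
qed

lemma fmem_mono: "fmem p a b \<Longrightarrow> q \<preceq> p \<Longrightarrow> fmem q a b"
  unfolding forces_mem_def by (rule dense_leq)

lemma fmem_dense: "dense p (\<lambda>q. fmem q a b) \<Longrightarrow> fmem p a b"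
  unfolding forces_mem_def by (rule dense_idem)

lemma fmem_cong1: "feq p a a' \<Longrightarrow> fmem p a b \<Longrightarrow> fmem p a' b"
  unfolding forces_mem_def
  by (erule dense_mono) (meson feq_sym feq_trans feq_mono)

lemma fmem_cong2: "feq p b b' \<Longrightarrow> fmem p a b \<Longrightarrow> fmem p a b'"
proof -
  assume eq: "feq p b b'" and "fmem p a b"
  then have "dense p (\<lambda>q. \<exists>c s. pair c s \<in> elts b \<and> q \<preceq> s \<and> feq q a c)"
    by (simp add: forces_mem_def)
  then show "fmem p a b'"
    unfolding forces_mem_def
  proof (rule dense_bind)
    fix q assume q: "q \<preceq> p" "\<exists>c s. pair c s \<in> elts b \<and> q \<preceq> s \<and> feq q a c"
    then obtain c s where c: "pair c s \<in> elts b" "q \<preceq> s" "feq q a c" by blast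
    show "dense q (\<lambda>q. \<exists>c s. pair c s \<in> elts b' \<and> q \<preceq> s \<and> feq q a c)"
    proof (rule dense_mono)
      show "dense q (\<lambda>r. \<exists>d t. pair d t \<in> elts b' \<and> r \<preceq> t \<and> feq r c d)"
        using eq c q(1) unfolding feq_iff[of p b b'] by blast
    qed (use c(3) feq_trans feq_mono in blast)
  qed
qed

lemma fmem_intro: "pair c s \<in> elts b \<Longrightarrow> p \<preceq> s \<Longrightarrow> feq p a c \<Longrightarrow> fmem p a b"
  unfolding forces_mem_def by (rule dense_always) (meson leq_trans feq_mono)

section \<open>Forcing of formulas and of derived connectives\<close>

lemma forces_mono: "forces P le \<phi> e p \<Longrightarrow> q \<preceq> p \<Longrightarrow> forces P le \<phi> e q"
  by (induction \<phi> arbitrary: e p q) (auto intro: fmem_mono feq_mono leq_trans)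

text \<open>Atomic formulas have this property by \<open>feq_dense\<close> and
  \<open>fmem_dense\<close>. For a negation, an extension forcing \<phi> would have a further
  extension that forces the negation as well.\<close>

lemma forces_dense: "dense p (\<lambda>q. forces P le \<phi> e q) \<Longrightarrow> forces P le \<phi> e p"
proof (induction \<phi> arbitrary: e p)
  case (Mem i j)
  show ?case
    by (simp, rule fmem_dense, rule dense_mono[OF Mem]) simp
next
  case (Eq i j)
  show ?case
    by (simp, rule feq_dense, rule dense_mono[OF Eq]) simp
next
  case (Neg \<phi>)
  show ?case
    using denseD[OF Neg.prems] forces_mono leq_in1 leq_refl
    by (simp, metis)
next
  case (Conj \<phi> \<psi>)
  then show ?case
    using dense_mono[OF Conj.prems] by simp
next
  case (All i \<phi>)
  have "forces P le \<phi> (e(i := x)) p" if "x \<in> names P" for x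
    by (rule All.IH, rule dense_mono[OF All.prems]) (use that in \<open>simp del: fun_upd_apply\<close>)
  then show ?case
    by simp
qed

text \<open>Unfolded, the implication only says that no condition below \<open>p\<close> forces both
  \<phi> and the negation of \<psi>. Below a condition forcing \<phi>, the conditions forcing \<psi>
  are therefore dense, and \<open>forces_dense\<close> gives \<psi> itself.\<close>

lemma forces_Imp:
  "forces P le (Imp \<phi> \<psi>) e p \<longleftrightarrow>
     (\<forall>q. q \<preceq> p \<longrightarrow> forces P le \<phi> e q \<longrightarrow> forces P le \<psi> e q)" (is "?L \<longleftrightarrow> ?R")
proof
  assume L: ?L
  show ?R
  proof (intro allI impI)
    fix q assume q: "q \<preceq> p" "forces P le \<phi> e q"
    show "forces P le \<psi> e q"
    proof (rule forces_dense, rule denseI)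
      fix r assume r: "r \<preceq> q"
      then have "r \<preceq> p" "forces P le \<phi> e r"
        using q leq_trans forces_mono by blast+
      then show "\<exists>s. s \<preceq> r \<and> forces P le \<psi> e s"
        using L leq_in1 by (auto simp: Imp_def)
    qed
  qed
next
  assume ?R
  then show ?L
    by (simp add: Imp_def) (meson leq_refl)
qed

lemma forces_Iff:
  "forces P le (Iff \<phi> \<psi>) e p \<longleftrightarrow>
     (\<forall>q. q \<preceq> p \<longrightarrow> forces P le \<phi> e q \<longleftrightarrow> forces P le \<psi> e q)"
  by (auto simp: Iff_def forces_Imp)

lemma forces_Ex:
  "forces P le (Ex i \<phi>) e p \<longleftrightarrow> dense p (\<lambda>q. \<exists>x\<in>names P. forces P le \<phi> (e(i := x)) q)"
  unfolding Ex_def dense_below_def by simp blast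

lemma forces_Disj:
  "forces P le (Disj \<phi> \<psi>) e p \<longleftrightarrow> dense p (\<lambda>q. forces P le \<phi> e q \<or> forces P le \<psi> e q)"
  unfolding Disj_def dense_below_def by simp blast

lemma forces_BAll:
  "i \<noteq> j \<Longrightarrow> forces P le (BAll i j \<phi>) e p \<longleftrightarrow>
     (\<forall>x\<in>names P. \<forall>q. q \<preceq> p \<longrightarrow> fmem q x (e j) \<longrightarrow> forces P le \<phi> (e(i := x)) q)"
  by (simp add: BAll_def forces_Imp)

lemma forces_BEx:
  "i \<noteq> j \<Longrightarrow> forces P le (BEx i j \<phi>) e p \<longleftrightarrow>
     dense p (\<lambda>q. \<exists>x\<in>names P. fmem q x (e j) \<and> forces P le \<phi> (e(i := x)) q)"
  by (simp add: BEx_def forces_Ex)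

section \<open>Extensionality and check names\<close>

lemma feqI:
  assumes "\<And>c s q. pair c s \<in> elts a \<Longrightarrow> q \<preceq> p \<Longrightarrow> q \<preceq> s \<Longrightarrow> fmem q c b"
    and "\<And>d t q. pair d t \<in> elts b \<Longrightarrow> q \<preceq> p \<Longrightarrow> q \<preceq> t \<Longrightarrow> fmem q d a"
  shows "feq p a b"
proof -
  have "dense q (\<lambda>r. \<exists>c s. pair c s \<in> elts a \<and> r \<preceq> s \<and> feq r c d)"
    if "pair d t \<in> elts b" and "q \<preceq> p" "q \<preceq> t" for d t q
  proof (rule dense_mono)
    show "dense q (\<lambda>r. \<exists>c s. pair c s \<in> elts a \<and> r \<preceq> s \<and> feq r d c)"
      using assms(2)[OF that] by (simp add: forces_mem_def)
  qed (use feq_sym in blast)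
  then show ?thesis
    using assms(1) unfolding feq_iff[of p a b] forces_mem_def by blast
qed

lemma feq_extensionality:
  assumes "a \<in> names P" "b \<in> names P"
    and "\<And>q x. q \<preceq> p \<Longrightarrow> x \<in> names P \<Longrightarrow> fmem q x a \<longleftrightarrow> fmem q x b"
  shows "feq p a b"
proof (rule feqI)
  fix c s q assume "pair c s \<in> elts a" "q \<preceq> p" "q \<preceq> s"
  then show "fmem q c b"
    using assms(3)[of q c] namesD[OF assms(1), of c s] fmem_intro[of c s a q c] by simp
next
  fix c s q assume "pair c s \<in> elts b" "q \<preceq> p" "q \<preceq> s"
  then show "fmem q c a"
    using assms(3)[of q c] namesD[OF assms(2), of c s] fmem_intro[of c s b q c] by simp
qed

lemma feq_iff_extensional:
  "a \<in> names P \<Longrightarrow> b \<in> names P \<Longrightarrow>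
     feq p a b \<longleftrightarrow> (\<forall>q. q \<preceq> p \<longrightarrow> (\<forall>x\<in>names P. fmem q x a \<longleftrightarrow> fmem q x b))"
  using feq_extensionality fmem_cong2 feq_mono feq_sym by metis

text \<open>\<open>check P y\<close> attaches every condition to each entry, so \<open>q\<close> may
  serve as its own tag and the order clause of \<open>forces_mem\<close> disappears. What remains
  says that an extension decides which element of \<open>y\<close> is meant. The same happens for
  \<open>upair_name\<close> below.\<close>

lemma fmem_check:
  "fmem p x (check P y) \<longleftrightarrow> dense p (\<lambda>q. \<exists>z\<in>elts y. feq q x (check P z))"
  unfolding forces_mem_def
proof (rule dense_cong)
  fix q assume "q \<preceq> p"
  then have "q \<in> elts P" "q \<preceq> q"
    using leq_in1 leq_refl by blast+
  then show "(\<exists>c s. pair c s \<in> elts (check P y) \<and> q \<preceq> s \<and> feq q x c) \<longleftrightarrow>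
      (\<exists>z\<in>elts y. feq q x (check P z))"
    unfolding elts_check mem_Collect_eq pair_eq_iff by blast
qed

lemma fmem_checkE:
  assumes "fmem p x (check P y)" "p \<in> elts P"
  obtains q z where "q \<preceq> p" "z \<in> elts y" "feq q x (check P z)"
  using denseD[OF assms(1)[unfolded fmem_check] leq_refl[OF assms(2)]] by blast

text \<open>Membership induction on \<open>x\<close>, with the condition arbitrary because
  \<open>fmem_checkE\<close> strengthens it in order to decide an element. For the converse
  inclusion the induction hypothesis is applied to the element of \<open>x\<close> so found.\<close>

lemma feq_check_iff: "p \<in> elts P \<Longrightarrow> feq p (check P x) (check P y) \<longleftrightarrow> x = y"
proof (induction x arbitrary: y p rule: wf_induct_rule[OF foundation])
  case (1 x)
  have "x = y" if eq: "feq p (check P x) (check P y)"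
  proof (rule extensionality, rule set_eqI)
    have *: "fmem p (check P z) (check P w)" if "z \<in> elts w" for z w
      by (rule fmem_intro[of "check P z" p]) (use that 1(2) in \<open>auto simp: elts_check\<close>)
    fix z
    show "z \<in> elts x \<longleftrightarrow> z \<in> elts y"
    proof
      assume z: "z \<in> elts x"
      then have "fmem p (check P z) (check P y)"
        by (intro fmem_cong2[OF eq] *)
      then obtain q w where "q \<preceq> p" "w \<in> elts y" "feq q (check P z) (check P w)"
        using 1(2) by (rule fmem_checkE)
      then show "z \<in> elts y"
        using 1(1)[of z q w] z leq_in1[of q p] by simp
    next
      assume z: "z \<in> elts y"
      then have "fmem p (check P z) (check P x)"
        by (intro fmem_cong2[OF feq_sym[OF eq]] *)
      then obtain q w where "q \<preceq> p" "w \<in> elts x" "feq q (check P z) (check P w)"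
        using 1(2) by (rule fmem_checkE)
      then show "z \<in> elts x"
        using 1(1)[of w q z] leq_in1[of q p] feq_sym[of q "check P z" "check P w"] by simp
    qed
  qed
  then show ?case
    by auto
qed

lemma fmem_check_check:
  assumes p: "p \<in> elts P"
  shows "fmem p (check P x) (check P y) \<longleftrightarrow> x \<in> elts y"
proof
  assume "fmem p (check P x) (check P y)"
  then obtain q z where "q \<preceq> p" "z \<in> elts y" "feq q (check P x) (check P z)"
    using p by (rule fmem_checkE)
  then show "x \<in> elts y"
    by (simp add: feq_check_iff[OF leq_in1])
next
  assume "x \<in> elts y"
  then show "fmem p (check P x) (check P y)"
    using p by (intro fmem_intro[of "check P x" p]) (auto simp: elts_check)
qed

section \<open>Names of unordered and ordered pairs\<close>

definition upair_name :: "'v \<Rightarrow> 'v \<Rightarrow> 'v" where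
  "upair_name a b = vset {pair c p | c p. c \<in> {a, b} \<and> p \<in> elts P}"

definition opair_name :: "'v \<Rightarrow> 'v \<Rightarrow> 'v" where
  "opair_name a b = upair_name (upair_name a a) (upair_name a b)"

lemma elts_upair_name: "elts (upair_name a b) = {pair c p | c p. c \<in> {a, b} \<and> p \<in> elts P}"
  unfolding upair_name_def by (rule elts_vset) (intro small_pairs small_doubleton small_elts)

lemma names_upair_name [simp]: "a \<in> names P \<Longrightarrow> b \<in> names P \<Longrightarrow> upair_name a b \<in> names P"
  by (rule names.intros) (auto simp: elts_upair_name)

lemma names_opair_name [simp]: "a \<in> names P \<Longrightarrow> b \<in> names P \<Longrightarrow> opair_name a b \<in> names P"
  by (simp add: opair_name_def)

lemma fmem_upair_name: "fmem p x (upair_name a b) \<longleftrightarrow> dense p (\<lambda>q. feq q x a \<or> feq q x b)"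
  unfolding forces_mem_def
proof (rule dense_cong)
  fix q assume "q \<preceq> p"
  then have "q \<in> elts P" "q \<preceq> q"
    using leq_in1 leq_refl by blast+
  then show "(\<exists>c s. pair c s \<in> elts (upair_name a b) \<and> q \<preceq> s \<and> feq q x c) \<longleftrightarrow>
      feq q x a \<or> feq q x b"
    unfolding elts_upair_name mem_Collect_eq pair_eq_iff by blast
qed

lemma fmem_upair_name_same: "fmem p x (upair_name a a) \<longleftrightarrow> feq p x a"
proof
  assume "fmem p x (upair_name a a)"
  then have "dense p (\<lambda>q. feq q x a)"
    by (simp add: fmem_upair_name)
  then show "feq p x a"
    by (rule feq_dense)
next
  assume "feq p x a"
  then have "dense p (\<lambda>q. feq q x a)"
    by (intro dense_always) (rule feq_mono)
  then show "fmem p x (upair_name a a)"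
    by (simp add: fmem_upair_name)
qed

lemma feq_upair_name_iff:
  assumes "z \<in> names P" "a \<in> names P" "b \<in> names P"
  shows "feq p z (upair_name a b) \<longleftrightarrow>
    (\<forall>x\<in>names P. \<forall>q. q \<preceq> p \<longrightarrow> fmem q x z \<longleftrightarrow> dense q (\<lambda>r. feq r x a \<or> feq r x b))"
  unfolding feq_iff_extensional[OF assms(1) names_upair_name[OF assms(2,3)]] fmem_upair_name
  by blast

text \<open>The fact \<open>single\<close> rewrites the clause for the singleton as equality with
  \<open>upair_name a a\<close>. The disequalities say that the bound variables are fresh, so that
  updating \<open>e\<close> leaves the arguments alone; the later translations use the same
  device.\<close>

lemma forces_pair_fm:
  assumes "e x \<in> names P" "e y \<in> names P" "e z \<in> names P"
  shows "forces P le (pair_fm z x y) e p \<longleftrightarrow> feq p (e z) (opair_name (e x) (e y))"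
proof -
  have single: "(\<forall>x\<in>names P. \<forall>q. q \<preceq> p \<longrightarrow> fmem q x z \<longleftrightarrow> feq q x a) \<longleftrightarrow>
      feq p z (upair_name a a)" if "z \<in> names P" "a \<in> names P" for z a p
    using that by (auto simp: feq_iff_extensional fmem_upair_name_same)
  let ?w = "Suc (z + x + y)"
  have [simp]: "z \<noteq> ?w" "x \<noteq> ?w" "y \<noteq> ?w" "z \<noteq> Suc ?w" "x \<noteq> Suc ?w" "y \<noteq> Suc ?w"
    by auto
  show ?thesis
    unfolding opair_name_def
    using assms
    by (subst feq_upair_name_iff)
      (simp_all add: pair_fm_def Let_def forces_Iff forces_Disj single
         feq_upair_name_iff[symmetric])
qed

lemma fmem_upair_name_left: "fmem q x (upair_name x y)"
  and fmem_upair_name_right: "fmem q y (upair_name x y)"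
  unfolding fmem_upair_name by (simp_all add: dense_always)

lemma upair_name_cong:
  assumes "feq p a a'" "feq p b b'"
  shows "feq p (upair_name a b) (upair_name a' b')"
proof (rule feqI)
  fix c s q assume "pair c s \<in> elts (upair_name a b)" and q: "q \<preceq> p"
  then have "c = a \<or> c = b"
    by (auto simp: elts_upair_name)
  then show "fmem q c (upair_name a' b')"
    using fmem_cong1[OF feq_sym[OF feq_mono[OF assms(1) q]] fmem_upair_name_left]
      fmem_cong1[OF feq_sym[OF feq_mono[OF assms(2) q]] fmem_upair_name_right] by blast
next
  fix c s q assume "pair c s \<in> elts (upair_name a' b')" and q: "q \<preceq> p"
  then have "c = a' \<or> c = b'"
    by (auto simp: elts_upair_name)
  then show "fmem q c (upair_name a b)"
    using fmem_cong1[OF feq_mono[OF assms(1) q] fmem_upair_name_left]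
      fmem_cong1[OF feq_mono[OF assms(2) q] fmem_upair_name_right] by blast
qed

lemma opair_name_cong:
  "feq p a a' \<Longrightarrow> feq p b b' \<Longrightarrow> feq p (opair_name a b) (opair_name a' b')"
  unfolding opair_name_def by (intro upair_name_cong)

lemma feq_upair_name_right:
  assumes "feq q (upair_name a b) (upair_name c d)"
  shows "dense q (\<lambda>r. feq r b c \<or> feq r b d)"
  using fmem_cong2[OF assms fmem_upair_name_right] unfolding fmem_upair_name .

text \<open>The Kuratowski member \<open>upair_name a b\<close> of the left pair must densely equal
  one of the two members of the right pair, and in both cases \<open>b\<close> is one of
  \<open>c\<close>, \<open>d\<close>.\<close>

lemma feq_opair_name_right:
  assumes "feq p (opair_name a b) (opair_name c d)"
  shows "dense p (\<lambda>q. feq q b c \<or> feq q b d)"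
proof (rule dense_bind)
  show "dense p (\<lambda>q. feq q (upair_name a b) (upair_name c c) \<or>
      feq q (upair_name a b) (upair_name c d))"
    using assms unfolding opair_name_def by (rule feq_upair_name_right)
  fix q
  assume "feq q (upair_name a b) (upair_name c c) \<or> feq q (upair_name a b) (upair_name c d)"
  then show "dense q (\<lambda>q. feq q b c \<or> feq q b d)"
  proof
    assume "feq q (upair_name a b) (upair_name c c)"
    from feq_upair_name_right[OF this] show ?thesis
      by (rule dense_mono) simp
  qed (rule feq_upair_name_right)
qed

lemma opair_name_inject:
  assumes eq: "feq p (opair_name a b) (opair_name c d)"
  shows "feq p a c" and "feq p b d"
proof -
  have "dense p (\<lambda>q. feq q (upair_name a a) (upair_name c c) \<or> feq q (upair_name a a) (upair_name c d))"
    using fmem_cong2[OF eq[unfolded opair_name_def] fmem_upair_name_left]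
    unfolding fmem_upair_name .
  then have "dense p (\<lambda>q. feq q a c)"
  proof (rule dense_mono)
    fix q assume "feq q (upair_name a a) (upair_name c c) \<or> feq q (upair_name a a) (upair_name c d)"
    then have "fmem q c (upair_name a a)"
      using fmem_cong2[OF feq_sym fmem_upair_name_left] by blast
    then show "feq q a c"
      by (simp add: fmem_upair_name_same feq_sym)
  qed
  then show ac: "feq p a c"
    by (rule feq_dense)
  show "feq p b d"
  proof (rule feq_dense, rule dense_bind[OF feq_opair_name_right[OF eq]])
    fix q assume q: "q \<preceq> p" "feq q b c \<or> feq q b d"
    show "dense q (\<lambda>q. feq q b d)"
    proof (rule dense_mono[OF dense_leq[OF feq_opair_name_right[OF feq_sym[OF eq]] q(1)]])
      fix r assume r: "r \<preceq> q" "feq r d a \<or> feq r d b"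
      \<comment> \<open>By symmetry \<open>d\<close> is one of \<open>a\<close>, \<open>b\<close>.
        The only case that does not yield \<open>b = d\<close> at once is \<open>b = c\<close> with
        \<open>d = a\<close>, and there \<open>a = c\<close> closes the chain.\<close>
      have "feq r b c \<or> feq r b d" "feq r a c"
        using q(2) feq_mono[OF _ r(1)] feq_mono[OF ac leq_trans[OF r(1) q(1)]] by blast+
      then show "feq r b d"
        using r(2) feq_sym[of r] feq_trans[of r b c a] feq_trans[of r b a d] by blast
    qed
  qed
qed

lemma forces_pair_mem_fm:
  assumes "e x \<in> names P" "e y \<in> names P" "e f \<in> names P"
  shows "forces P le (pair_mem_fm x y f) e p \<longleftrightarrow> fmem p (opair_name (e x) (e y)) (e f)"
proof -
  let ?z = "Suc (x + y + f)" and ?o = "opair_name (e x) (e y)"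
  have [simp]: "x \<noteq> ?z" "y \<noteq> ?z" "f \<noteq> ?z" "?z \<noteq> f"
    by auto
  have "forces P le (pair_mem_fm x y f) e p \<longleftrightarrow>
      dense p (\<lambda>q. \<exists>z\<in>names P. fmem q z (e f) \<and> feq q z ?o)"
    using assms by (simp add: pair_mem_fm_def Let_def forces_BEx forces_pair_fm cong: bex_cong)
  also have "\<dots> \<longleftrightarrow> fmem p ?o (e f)"
  proof
    assume "dense p (\<lambda>q. \<exists>z\<in>names P. fmem q z (e f) \<and> feq q z ?o)"
    then have "dense p (\<lambda>q. fmem q ?o (e f))"
      by (rule dense_mono) (use fmem_cong1 in blast)
    then show "fmem p ?o (e f)"
      by (rule fmem_dense)
  next
    assume *: "fmem p ?o (e f)"
    have "?o \<in> names P"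
      using assms by simp
    then show "dense p (\<lambda>q. \<exists>z\<in>names P. fmem q z (e f) \<and> feq q z ?o)"
      using fmem_mono[OF *] feq_refl by (intro dense_always) blast
  qed
  finally show ?thesis .
qed

section \<open>The Rothberger formula in terms of names\<close>

definition forces_function :: "'v \<Rightarrow> 'v \<Rightarrow> 'v \<Rightarrow> bool" where
  "forces_function p f A \<longleftrightarrow>
     (\<forall>z\<in>names P. \<forall>q. q \<preceq> p \<longrightarrow> fmem q z f \<longrightarrow>
        dense q (\<lambda>r. \<exists>x\<in>names P. fmem r x A \<and>
          dense r (\<lambda>s. \<exists>y\<in>names P. feq s z (opair_name x y)))) \<and>
     (\<forall>x\<in>names P. \<forall>q. q \<preceq> p \<longrightarrow> fmem q x A \<longrightarrow>
        dense q (\<lambda>r. \<exists>y\<in>names P. \<forall>z\<in>names P. \<forall>s. s \<preceq> r \<longrightarrow>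
          fmem s (opair_name x z) f \<longleftrightarrow> feq s z y))"

definition forces_open :: "'v \<Rightarrow> 'v \<Rightarrow> 'v \<Rightarrow> 'v \<Rightarrow> bool" where
  "forces_open p U X T \<longleftrightarrow>
     (\<forall>x\<in>names P. \<forall>q. q \<preceq> p \<longrightarrow> fmem q x U \<longrightarrow> fmem q x X \<and>
        dense q (\<lambda>r. \<exists>B\<in>names P. fmem r B T \<and> fmem r x B \<and>
          (\<forall>y\<in>names P. \<forall>s. s \<preceq> r \<longrightarrow> fmem s y B \<longrightarrow> fmem s y U)))"

definition forces_cover :: "'v \<Rightarrow> 'v \<Rightarrow> 'v \<Rightarrow> 'v \<Rightarrow> bool" where
  "forces_cover p C X T \<longleftrightarrow>
     (\<forall>U\<in>names P. \<forall>q. q \<preceq> p \<longrightarrow> fmem q U C \<longrightarrow> forces_open q U X T) \<and>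
     (\<forall>x\<in>names P. \<forall>q. q \<preceq> p \<longrightarrow> fmem q x X \<longrightarrow>
        dense q (\<lambda>r. \<exists>U\<in>names P. fmem r U C \<and> fmem r x U))"

definition forces_covers :: "'v \<Rightarrow> 'v \<Rightarrow> 'v \<Rightarrow> 'v \<Rightarrow> bool" where
  "forces_covers p f X T \<longleftrightarrow>
     (\<forall>n\<in>names P. \<forall>C\<in>names P. \<forall>q. q \<preceq> p \<longrightarrow>
        fmem q (opair_name n C) f \<longrightarrow> forces_cover q C X T)"

definition forces_selection :: "'v \<Rightarrow> 'v \<Rightarrow> 'v \<Rightarrow> bool" where
  "forces_selection p f g \<longleftrightarrow>
     (\<forall>n\<in>names P. \<forall>C\<in>names P. \<forall>U\<in>names P. \<forall>q. q \<preceq> p \<longrightarrow>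
        fmem q (opair_name n C) f \<and> fmem q (opair_name n U) g \<longrightarrow> fmem q U C)"

definition forces_range_covers :: "'v \<Rightarrow> 'v \<Rightarrow> 'v \<Rightarrow> 'v \<Rightarrow> bool" where
  "forces_range_covers p g X N \<longleftrightarrow>
     (\<forall>x\<in>names P. \<forall>q. q \<preceq> p \<longrightarrow> fmem q x X \<longleftrightarrow>
        dense q (\<lambda>r. \<exists>n\<in>names P. fmem r n N \<and>
          dense r (\<lambda>s. \<exists>U\<in>names P. fmem s (opair_name n U) g \<and> fmem s x U)))"

lemma forces_function_fm:
  assumes "e f \<in> names P" "e A \<in> names P"
  shows "forces P le (function_fm f A) e p \<longleftrightarrow> forces_function p (e f) (e A)"
proof -
  let ?x = "Suc (f + A)"
  have [simp]: "f \<noteq> ?x" "A \<noteq> ?x" "f \<noteq> Suc ?x" "A \<noteq> Suc ?x" "f \<noteq> Suc (Suc ?x)" "A \<noteq> Suc (Suc ?x)"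
    "?x \<noteq> f" "?x \<noteq> A" "Suc ?x \<noteq> f" "Suc ?x \<noteq> A" "Suc (Suc ?x) \<noteq> f" "Suc (Suc ?x) \<noteq> A"
    by auto
  show ?thesis
    using assms
    by (simp add: function_fm_def Let_def forces_BAll forces_BEx forces_Ex forces_Iff
        forces_pair_fm forces_pair_mem_fm forces_function_def cong: bex_cong ball_cong)
qed

lemma forces_open_fm:
  assumes "e U \<in> names P" "e X \<in> names P" "e T \<in> names P"
  shows "forces P le (open_fm U X T) e p \<longleftrightarrow> forces_open p (e U) (e X) (e T)"
proof -
  let ?x = "Suc (U + X + T)"
  have [simp]: "U \<noteq> ?x" "X \<noteq> ?x" "T \<noteq> ?x" "U \<noteq> Suc ?x" "X \<noteq> Suc ?x" "T \<noteq> Suc ?x"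
    "U \<noteq> Suc (Suc ?x)" "X \<noteq> Suc (Suc ?x)" "T \<noteq> Suc (Suc ?x)"
    "?x \<noteq> U" "Suc ?x \<noteq> T"
    by auto
  show ?thesis
    using assms
    by (simp add: open_fm_def Let_def forces_BAll forces_BEx forces_open_def
        cong: bex_cong ball_cong)
qed

lemma forces_open_cover_fm:
  assumes "e C \<in> names P" "e X \<in> names P" "e T \<in> names P"
  shows "forces P le (open_cover_fm C X T) e p \<longleftrightarrow> forces_cover p (e C) (e X) (e T)"
proof -
  let ?U = "Suc (C + X + T)"
  have [simp]: "C \<noteq> ?U" "X \<noteq> ?U" "T \<noteq> ?U" "C \<noteq> Suc ?U" "X \<noteq> Suc ?U" "T \<noteq> Suc ?U"
    "?U \<noteq> C" "Suc ?U \<noteq> X"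
    by auto
  show ?thesis
    using assms
    by (simp add: open_cover_fm_def Let_def forces_BAll forces_BEx forces_open_fm
        forces_cover_def cong: bex_cong ball_cong)
qed

text \<open>After this translation the argument works with predicates on names. As an existential
  formula is forced densely, the selector \<open>g\<close> may be found below a stronger condition;
  this leaves room to pass below a strongly generic one.\<close>

lemma forces_rothberger_fm:
  assumes "e 0 \<in> names P" "e 1 \<in> names P" "e 2 \<in> names P"
  shows "forces P le (rothberger_fm 0 1 2) e p \<longleftrightarrow>
    (\<forall>f\<in>names P. \<forall>q. q \<preceq> p \<longrightarrow>
       forces_function q f (e 2) \<and> forces_covers q f (e 0) (e 1) \<longrightarrow>
       dense q (\<lambda>r. \<exists>g\<in>names P. forces_function r g (e 2) \<and> forces_selection r f g \<and>
         forces_range_covers r g (e 0) (e 2)))"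
  using assms
  by (simp add: rothberger_fm_def Let_def forces_Imp forces_Iff forces_Ex forces_BEx
      forces_function_fm forces_pair_mem_fm forces_open_cover_fm
      forces_covers_def forces_selection_def forces_range_covers_def cong: bex_cong ball_cong)

text \<open>Densely, both \<open>y\<close> and \<open>y'\<close> equal the value \<open>w\<close>
  that \<open>forces_function\<close> provides at \<open>x\<close>.\<close>

lemma forces_function_unique:
  assumes f: "forces_function p f A" and q: "q \<preceq> p" and x: "fmem q x A"
    and names: "x \<in> names P" "y \<in> names P" "y' \<in> names P"
    and mem: "fmem q (opair_name x y) f" "fmem q (opair_name x y') f"
  shows "feq q y y'"
proof (rule feq_dense)
  have "dense q (\<lambda>r. \<exists>w\<in>names P. \<forall>z\<in>names P. \<forall>s. s \<preceq> r \<longrightarrow>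
      fmem s (opair_name x z) f \<longleftrightarrow> feq s z w)"
    using f q x names(1) unfolding forces_function_def by blast
  then show "dense q (\<lambda>r. feq r y y')"
  proof (rule dense_mono)
    fix r assume r: "r \<preceq> q" and "\<exists>w\<in>names P. \<forall>z\<in>names P. \<forall>s. s \<preceq> r \<longrightarrow>
      fmem s (opair_name x z) f \<longleftrightarrow> feq s z w"
    then obtain w where w: "\<And>z. z \<in> names P \<Longrightarrow> fmem r (opair_name x z) f \<longleftrightarrow> feq r z w"
      using leq_refl[OF leq_in1[OF r]] by blast
    have "feq r y w" "feq r y' w"
      using w names(2,3) mem[THEN fmem_mono, OF r] by blast+
    then show "feq r y y'"
      using feq_sym feq_trans by blast
  qed
qed

text \<open>Zorn's lemma for the antichains contained in \<open>D\<close>. A condition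
  \<open>d\<close> of \<open>D\<close> compatible with no member of \<open>A\<close> could be added;
  by maximality it would be a member, and it is compatible with itself.\<close>

lemma maximal_antichain:
  obtains A where "A \<subseteq> D" "\<And>a b r. a \<in> A \<Longrightarrow> b \<in> A \<Longrightarrow> r \<preceq> a \<Longrightarrow> r \<preceq> b \<Longrightarrow> a = b"
    "\<And>d. d \<in> D \<Longrightarrow> d \<in> elts P \<Longrightarrow> \<exists>a\<in>A. \<exists>r. r \<preceq> d \<and> r \<preceq> a"
proof -
  define \<A> where "\<A> = {A. A \<subseteq> D \<and> (\<forall>a\<in>A. \<forall>b\<in>A. \<forall>r. r \<preceq> a \<longrightarrow> r \<preceq> b \<longrightarrow> a = b)}"
  have "\<exists>A\<in>\<A>. \<forall>B\<in>\<A>. A \<subseteq> B \<longrightarrow> B = A"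
  proof (rule subset_Zorn')
    fix C assume C: "subset.chain \<A> C"
    show "\<Union>C \<in> \<A>"
      unfolding \<A>_def
    proof (intro CollectI conjI ballI allI impI)
      show "\<Union>C \<subseteq> D"
        using C by (auto simp: \<A>_def subset_chain_def)
      fix a b r assume "a \<in> \<Union>C" "b \<in> \<Union>C" and r: "r \<preceq> a" "r \<preceq> b"
      then obtain A B where "A \<in> C" "a \<in> A" "B \<in> C" "b \<in> B"
        by blast
      moreover from this have "A \<subseteq> B \<or> B \<subseteq> A" "A \<in> \<A>" "B \<in> \<A>"
        using C by (auto simp: subset_chain_def)
      ultimately show "a = b"
        using r unfolding \<A>_def by blast
    qed
  qed
  then obtain A where A: "A \<in> \<A>" and max: "\<And>B. B \<in> \<A> \<Longrightarrow> A \<subseteq> B \<Longrightarrow> B = A"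
    by blast
  have "\<exists>a\<in>A. \<exists>r. r \<preceq> d \<and> r \<preceq> a" if d: "d \<in> D" "d \<in> elts P" for d
  proof (rule ccontr)
    assume *: "\<not> (\<exists>a\<in>A. \<exists>r. r \<preceq> d \<and> r \<preceq> a)"
    then have "insert d A \<in> \<A>"
      using A d unfolding \<A>_def by blast
    then have "d \<in> A"
      using max by blast
    then show False
      using * leq_refl[OF d(2)] by blast
  qed
  then show thesis
    using A that[of A] unfolding \<A>_def by blast
qed

section \<open>Choosing from the covers in the extension\<close>

text \<open>\<open>B\<close> is a ground-model set, so its inclusion in the member \<open>U\<close>
  of the \<open>n\<close>-th cover is expressed pointwise, through check names of its
  elements.\<close>

definition forces_refines :: "'v \<Rightarrow> nat \<Rightarrow> 'v \<Rightarrow> 'v \<Rightarrow> bool" where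
  "forces_refines f n B q \<longleftrightarrow>
     (\<exists>C\<in>names P. \<exists>U\<in>names P. fmem q (opair_name (check P (ord_of_nat n)) C) f \<and> fmem q U C \<and>
        (\<forall>y\<in>elts B. fmem q (check P y) U))"

lemma forces_refines_mono: "forces_refines f n B p \<Longrightarrow> q \<preceq> p \<Longrightarrow> forces_refines f n B q"
  unfolding forces_refines_def using fmem_mono by meson

text \<open>Strengthen \<open>q\<close> to fix in turn the value \<open>C\<close> of
  \<open>f\<close> at \<open>n\<close>, a member \<open>U\<close> of \<open>C\<close> around
  \<open>x\<close>, a name \<open>B'\<close> of a basic set around \<open>x\<close> inside
  \<open>U\<close>, and the set \<open>B\<close> that \<open>B'\<close> denotes. The last step is
  possible because the basis \<tau> lies in the ground model.\<close>

lemma forces_refines_dense: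
  assumes f: "forces_function p f (check P omega)" "forces_covers p f (check P X) (check P \<tau>)"
    and q: "q \<preceq> p" and x: "x \<in> elts X"
  shows "\<exists>r. r \<preceq> q \<and> (\<exists>B\<in>elts \<tau>. x \<in> elts B \<and> forces_refines f n B r)"
proof -
  let ?n = "check P (ord_of_nat n)"
  have "fmem q ?n (check P omega)"
    using q by (simp add: fmem_check_check leq_in1)
  then have "dense q (\<lambda>r. \<exists>C\<in>names P. \<forall>z\<in>names P. \<forall>s. s \<preceq> r \<longrightarrow>
      fmem s (opair_name ?n z) f \<longleftrightarrow> feq s z C)"
    using f(1) q names_check unfolding forces_function_def by blast
  from denseD[OF this leq_refl[OF leq_in1[OF q]]]
  obtain r C where r: "r \<preceq> q" and C: "C \<in> names P" "fmem r (opair_name ?n C) f"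
    using leq_refl[OF leq_in1] by force
  have cover: "forces_cover r C (check P X) (check P \<tau>)"
    using f(2) C leq_trans[OF r q] names_check unfolding forces_covers_def by blast
  have rr: "r \<preceq> r"
    using leq_refl[OF leq_in1[OF r]] .
  have U: "forces_open s U (check P X) (check P \<tau>)"
    if "U \<in> names P" "s \<preceq> r" "fmem s U C" for U s
    using cover that unfolding forces_cover_def by blast
  have "fmem r (check P x) (check P X)"
    using x leq_in1[OF r] by (simp add: fmem_check_check)
  then have "dense r (\<lambda>r. \<exists>U\<in>names P. fmem r U C \<and> fmem r (check P x) U)"
    using cover rr names_check unfolding forces_cover_def by blast
  from denseD[OF this rr] obtain s U where s: "s \<preceq> r" and
    sU: "U \<in> names P" "fmem s U C" "fmem s (check P x) U"
    by blast
  have ss: "s \<preceq> s"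
    using leq_refl[OF leq_in1[OF s]] .
  have "dense s (\<lambda>r. \<exists>B\<in>names P. fmem r B (check P \<tau>) \<and> fmem r (check P x) B \<and>
          (\<forall>y\<in>names P. \<forall>s. s \<preceq> r \<longrightarrow> fmem s y B \<longrightarrow> fmem s y U))"
    using U[OF sU(1) s sU(2)] sU(3) ss names_check unfolding forces_open_def by blast
  from denseD[OF this ss] obtain t B' where t: "t \<preceq> s" and
    B': "fmem t B' (check P \<tau>)" "fmem t (check P x) B'"
    "\<And>y u. y \<in> names P \<Longrightarrow> u \<preceq> t \<Longrightarrow> fmem u y B' \<Longrightarrow> fmem u y U"
    by blast
  obtain u B where u: "u \<preceq> t" and B: "B \<in> elts \<tau>" "feq u B' (check P B)"
    using B'(1) leq_in1[OF t] by (rule fmem_checkE)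
  have us: "u \<preceq> s" and ur: "u \<preceq> r"
    using leq_trans u t s by blast+
  have "x \<in> elts B"
    using fmem_cong2[OF B(2) fmem_mono[OF B'(2) u]] leq_in1[OF u] by (simp add: fmem_check_check)
  moreover have "fmem u (check P y) U" if "y \<in> elts B" for y
    using B'(3)[OF names_check u] fmem_cong2[OF feq_sym[OF B(2)], of "check P y"] that leq_in1[OF u]
    by (simp add: fmem_check_check)
  then have "forces_refines f n B u"
    unfolding forces_refines_def
    using C(1) fmem_mono[OF C(2) ur] sU(1) fmem_mono[OF sU(2) us] by blast
  ultimately show ?thesis
    using B(1) leq_trans[OF ur r] by blast
qed

text \<open>The name \<open>g\<close> below picks, for every \<open>n\<close>, a member of the \<open>n\<close>-th cover along a maximal
  antichain of conditions which decide whether some member includes \<open>B n\<close>.\<close>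

lemma selection_name:
  fixes B :: "nat \<Rightarrow> 'v"
  assumes f: "f \<in> names P" "forces_function p f (check P omega)"
      "forces_covers p f (check P X) (check P \<tau>)"
    and X: "elts X \<noteq> {}"
    and B: "\<And>q x. q \<preceq> p \<Longrightarrow> x \<in> elts X \<Longrightarrow>
      \<exists>n. x \<in> elts (B n) \<and> (\<exists>r. r \<preceq> q \<and> forces_refines f n (B n) r)"
  shows "\<exists>g\<in>names P. forces_function p g (check P omega) \<and> forces_selection p f g \<and>
    forces_range_covers p g (check P X) (check P omega)"
proof -
  let ?n = "\<lambda>n. check P (ord_of_nat n)"
  \<comment> \<open>The second alternative says that no extension of \<open>q\<close> forces a
    member to include \<open>B n\<close>; then any member of the cover may be \<open>U\<close>. This
    makes good conditions dense below \<open>p\<close>.\<close>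
  define good where "good n q C U \<longleftrightarrow> q \<preceq> p \<and> C \<in> names P \<and> U \<in> names P \<and>
      fmem q (opair_name (?n n) C) f \<and> fmem q U C \<and>
      ((\<forall>y\<in>elts (B n). fmem q (check P y) U) \<or> (\<forall>r. r \<preceq> q \<longrightarrow> \<not> forces_refines f n (B n) r))"
    for n q C U
  have good_dense: "\<exists>r C U. r \<preceq> q \<and> good n r C U" if q: "q \<preceq> p" for n q
  proof (cases "\<exists>r. r \<preceq> q \<and> forces_refines f n (B n) r")
    case True
    then show ?thesis
      unfolding good_def forces_refines_def using leq_trans[OF _ q] by blast
  next
    case False
    \<comment> \<open>A point of \<open>X\<close> yields some member of the cover, to be used as a
      default.\<close>
    obtain x where "x \<in> elts X"
      using X by blast
    then obtain r b where r: "r \<preceq> q" and "forces_refines f n b r"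
      using forces_refines_dense[OF f(2,3) q] by blast
    then obtain C U where "C \<in> names P" "U \<in> names P"
      "fmem r (opair_name (?n n) C) f" "fmem r U C"
      unfolding forces_refines_def by blast
    then have "good n r C U"
      unfolding good_def using False leq_trans[OF r q] leq_trans[OF _ r] by blast
    then show ?thesis
      using r by blast
  qed
  have "\<exists>A. A \<subseteq> {q. \<exists>C U. good n q C U} \<and>
      (\<forall>a\<in>A. \<forall>b\<in>A. \<forall>r. r \<preceq> a \<longrightarrow> r \<preceq> b \<longrightarrow> a = b) \<and>
      (\<forall>q. q \<preceq> p \<longrightarrow> (\<exists>a\<in>A. \<exists>r. r \<preceq> q \<and> r \<preceq> a))" for n
  proof (rule maximal_antichain[of "{q. \<exists>C U. good n q C U}"])
    fix A
    assume A: "A \<subseteq> {q. \<exists>C U. good n q C U}"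
      "\<And>a b r. a \<in> A \<Longrightarrow> b \<in> A \<Longrightarrow> r \<preceq> a \<Longrightarrow> r \<preceq> b \<Longrightarrow> a = b"
      "\<And>d. d \<in> {q. \<exists>C U. good n q C U} \<Longrightarrow> d \<in> elts P \<Longrightarrow> \<exists>a\<in>A. \<exists>r. r \<preceq> d \<and> r \<preceq> a"
    have "\<exists>a\<in>A. \<exists>r. r \<preceq> q \<and> r \<preceq> a" if q: "q \<preceq> p" for q
    proof -
      obtain d C U where d: "d \<preceq> q" "good n d C U"
        using good_dense[OF q] by blast
      then obtain a r where "a \<in> A" "r \<preceq> d" "r \<preceq> a"
        using A(3)[of d] leq_in1[OF d(1)] by blast
      then show ?thesis
        using leq_trans[OF _ d(1)] by blast
    qed
    then show ?thesis
      using A(1,2) by blast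
  qed
  then obtain A where A: "\<And>n. A n \<subseteq> {q. \<exists>C U. good n q C U}"
    and anti: "\<And>n a b r. a \<in> A n \<Longrightarrow> b \<in> A n \<Longrightarrow> r \<preceq> a \<Longrightarrow> r \<preceq> b \<Longrightarrow> a = b"
    and predense: "\<And>n q. q \<preceq> p \<Longrightarrow> \<exists>a\<in>A n. \<exists>r. r \<preceq> q \<and> r \<preceq> a"
    by metis
  obtain C U where good: "\<And>n a. a \<in> A n \<Longrightarrow> good n a (C n a) (U n a)"
    using A by (simp add: subset_iff) metis
  have AP: "a \<preceq> p" "a \<in> elts P" "U n a \<in> names P" "C n a \<in> names P" if "a \<in> A n" for n a
    using good[OF that] leq_in1 unfolding good_def by blast+
  \<comment> \<open>Tagging the entry with \<open>a\<close> makes \<open>U n a\<close> the value of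
    \<open>g\<close> at \<open>n\<close> whenever \<open>a\<close> is in the generic filter.\<close>
  define g where "g = vset (\<Union>n. (\<lambda>a. pair (opair_name (?n n) (U n a)) a) ` A n)"
  have "small (A n)" for n
    using AP by (intro small_subset[OF small_elts[of P]]) blast
  then have elts_g: "elts g = (\<Union>n. (\<lambda>a. pair (opair_name (?n n) (U n a)) a) ` A n)"
    unfolding g_def by (intro elts_vset small_UN_nat small_image)
  have g: "g \<in> names P"
    by (rule names.intros) (use AP names_check names_opair_name in \<open>unfold elts_g; blast\<close>)
  have fmem_g: "fmem q z g \<longleftrightarrow>
      dense q (\<lambda>r. \<exists>n. \<exists>a\<in>A n. r \<preceq> a \<and> feq r z (opair_name (?n n) (U n a)))" for q z
    unfolding forces_mem_def
  proof (rule dense_cong)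
    fix r
    show "(\<exists>c s. pair c s \<in> elts g \<and> r \<preceq> s \<and> feq r z c) \<longleftrightarrow>
        (\<exists>n. \<exists>a\<in>A n. r \<preceq> a \<and> feq r z (opair_name (?n n) (U n a)))"
      unfolding elts_g UN_iff image_iff pair_eq_iff by blast
  qed
  have entry: "dense q (\<lambda>r. \<exists>n. \<exists>a\<in>A n. r \<preceq> a \<and> feq r x (?n n) \<and> feq r y (U n a))"
    if "fmem q (opair_name x y) g" for q x y
    using that[unfolded fmem_g]
    by (rule dense_mono) (use opair_name_inject in blast)
  have entry_in: "fmem q (opair_name x y) g"
    if "a \<in> A n" "q \<preceq> a" "feq q x (?n n)" "feq q y (U n a)" for q x y n a
    using that by (intro fmem_intro[OF _ that(2) opair_name_cong[OF that(3,4)]])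
      (auto simp: elts_g)
  have n_omega: "fmem q (?n n) (check P omega)" if "q \<in> elts P" for q n
    using that by (simp add: fmem_check_check)
  have "forces_function p g (check P omega)"
    unfolding forces_function_def
  proof (intro conjI ballI allI impI)
    fix z q assume "fmem q z g"
    then show "dense q (\<lambda>r. \<exists>x\<in>names P. fmem r x (check P omega) \<and>
          dense r (\<lambda>s. \<exists>y\<in>names P. feq s z (opair_name x y)))"
      unfolding fmem_g
    proof (rule dense_mono)
      fix r assume r: "r \<preceq> q" "\<exists>n. \<exists>a\<in>A n. r \<preceq> a \<and> feq r z (opair_name (?n n) (U n a))"
      then obtain n a where a: "a \<in> A n" "feq r z (opair_name (?n n) (U n a))"
        by blast
      have "dense r (\<lambda>s. \<exists>y\<in>names P. feq s z (opair_name (?n n) y))"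
        by (rule dense_always) (use feq_mono[OF a(2)] AP(3)[OF a(1)] in blast)
      then show "\<exists>x\<in>names P. fmem r x (check P omega) \<and>
          dense r (\<lambda>s. \<exists>y\<in>names P. feq s z (opair_name x y))"
        using n_omega[OF leq_in1[OF r(1)]] names_check by blast
    qed
  next
    fix x q assume x: "x \<in> names P" and q: "q \<preceq> p" and "fmem q x (check P omega)"
    then show "dense q (\<lambda>r. \<exists>y\<in>names P. \<forall>z\<in>names P. \<forall>s. s \<preceq> r \<longrightarrow>
          fmem s (opair_name x z) g \<longleftrightarrow> feq s z y)"
      unfolding fmem_check
    proof (elim dense_bind, intro denseI)
      fix r r'
      assume r: "r \<preceq> q" "\<exists>z\<in>elts omega. feq r x (check P z)" "r' \<preceq> r"
      then obtain n where n: "feq r x (?n n)"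
        by auto
      \<comment> \<open>Below \<open>a\<close> the value is settled: any entry of \<open>g\<close>
        at \<open>n\<close> that is active at an extension of \<open>a\<close> has index
        \<open>n\<close> by injectivity, and its tag is compatible with \<open>a\<close>, hence
        equal to \<open>a\<close>.\<close>
      obtain a s where a: "a \<in> A n" "s \<preceq> r'" "s \<preceq> a"
        using predense[OF leq_trans[OF r(3) leq_trans[OF r(1) q]]] by blast
      have "fmem t (opair_name x z) g \<longleftrightarrow> feq t z (U n a)" if t: "t \<preceq> s" for t z
      proof
        have tx: "feq t x (?n n)" and ta: "t \<preceq> a"
          using feq_mono[OF n] leq_trans[OF t] a r(3) leq_trans by blast+
        show "fmem t (opair_name x z) g" if "feq t z (U n a)"
          using entry_in[OF a(1) ta tx that] .
        assume "fmem t (opair_name x z) g"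
        from entry[OF this] have "dense t (\<lambda>u. feq u z (U n a))"
        proof (rule dense_mono)
          fix u assume u: "u \<preceq> t" "\<exists>m. \<exists>b\<in>A m. u \<preceq> b \<and> feq u x (?n m) \<and> feq u z (U m b)"
          then obtain m b where b: "b \<in> A m" "u \<preceq> b" "feq u x (?n m)" "feq u z (U m b)"
            by blast
          have "feq u (?n m) (?n n)"
            using feq_trans[OF feq_sym[OF b(3)] feq_mono[OF tx u(1)]] .
          then have "m = n"
            by (simp add: feq_check_iff[OF leq_in1[OF u(1)]] inj_eq[OF inj_ord_of_nat])
          moreover from this have "b = a"
            using anti[of b n a u] b a(1) leq_trans[OF u(1) ta] by blast
          ultimately show "feq u z (U n a)"
            using b(4) by simp
        qed
        then show "feq t z (U n a)"
          by (rule feq_dense)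
      qed
      then show "\<exists>s. s \<preceq> r' \<and> (\<exists>y\<in>names P. \<forall>z\<in>names P. \<forall>t. t \<preceq> s \<longrightarrow>
          fmem t (opair_name x z) g \<longleftrightarrow> feq t z y)"
        using a(2) AP(3)[OF a(1)] by blast
    qed
  qed
  moreover have "forces_selection p f g"
    unfolding forces_selection_def
  proof (intro ballI allI impI)
    fix n D V q
    assume names: "n \<in> names P" "D \<in> names P" "V \<in> names P" and q: "q \<preceq> p"
      and *: "fmem q (opair_name n D) f \<and> fmem q (opair_name n V) g"
    have "dense q (\<lambda>r. fmem r V D)"
      using entry[OF conjunct2[OF *]]
    proof (rule dense_mono)
      fix r assume r: "r \<preceq> q" "\<exists>m. \<exists>a\<in>A m. r \<preceq> a \<and> feq r n (?n m) \<and> feq r V (U m a)"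
      then obtain m a where a: "a \<in> A m" "r \<preceq> a" "feq r n (?n m)" "feq r V (U m a)"
        by blast
      \<comment> \<open>Both \<open>C m a\<close> and \<open>D\<close> are values of
        \<open>f\<close> at \<open>m\<close>, so they agree, and \<open>V\<close>, which equals
        \<open>U m a\<close>, is a member of \<open>D\<close>.\<close>
      have "fmem r (opair_name (?n m) (C m a)) f" and UC: "fmem r (U m a) (C m a)"
        using good[OF a(1)] fmem_mono[OF _ a(2)] unfolding good_def by blast+
      moreover have "fmem r (opair_name (?n m) D) f"
        using fmem_cong1[OF opair_name_cong[OF a(3) feq_refl] fmem_mono[OF conjunct1[OF *] r(1)]] .
      ultimately have "feq r (C m a) D"
        using forces_function_unique[OF f(2) leq_trans[OF r(1) q] n_omega[OF leq_in1[OF r(1)]]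
            names_check AP(4)[OF a(1)] names(2)] by blast
      then show "fmem r V D"
        using fmem_cong1[OF feq_sym[OF a(4)] fmem_cong2[OF _ UC]] by blast
    qed
    then show "fmem q V D"
      by (rule fmem_dense)
  qed
  moreover have "forces_range_covers p g (check P X) (check P omega)"
    unfolding forces_range_covers_def
  proof (intro ballI allI impI iffI)
    fix x q assume q: "q \<preceq> p" and "fmem q x (check P X)"
    then show "dense q (\<lambda>r. \<exists>n\<in>names P. fmem r n (check P omega) \<and>
          dense r (\<lambda>s. \<exists>V\<in>names P. fmem s (opair_name n V) g \<and> fmem s x V))"
      unfolding fmem_check[of _ x]
    proof (elim dense_bind, intro denseI)
      fix r r'
      assume r: "r \<preceq> q" "\<exists>z\<in>elts X. feq r x (check P z)" "r' \<preceq> r"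
      then obtain z where z: "z \<in> elts X" "feq r x (check P z)"
        by blast
      obtain n s where s: "z \<in> elts (B n)" "s \<preceq> r'" "forces_refines f n (B n) s"
        using B[OF leq_trans[OF r(3) leq_trans[OF r(1) q]] z(1)] by blast
      obtain a t where a: "a \<in> A n" "t \<preceq> s" "t \<preceq> a"
        using predense[OF leq_trans[OF s(2) leq_trans[OF r(3) leq_trans[OF r(1) q]]]] by blast
      \<comment> \<open>The extension \<open>t\<close> of \<open>a\<close> forces some member to
        include \<open>B n\<close>, so \<open>a\<close> must be good by its first
        alternative.\<close>
      have "fmem a (check P z) (U n a)"
        using good[OF a(1)] s(1) forces_refines_mono[OF s(3) a(2)] a(3) unfolding good_def by blast
      moreover have tr: "t \<preceq> r'" "t \<preceq> r"
        using leq_trans a(2) s(2) r(3) by blast+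
      ultimately have "fmem t x (U n a)"
        using fmem_cong1[OF feq_sym[OF feq_mono[OF z(2)]] fmem_mono[OF _ a(3)]] by blast
      then have "dense t (\<lambda>s. \<exists>V\<in>names P. fmem s (opair_name (?n n) V) g \<and> fmem s x V)"
        using entry_in[OF a(1) leq_trans[OF _ a(3)] feq_refl feq_refl] AP(3)[OF a(1)]
        by (intro dense_always) (blast intro: fmem_mono)
      then show "\<exists>t. t \<preceq> r' \<and> (\<exists>n\<in>names P. fmem t n (check P omega) \<and>
          dense t (\<lambda>s. \<exists>V\<in>names P. fmem s (opair_name n V) g \<and> fmem s x V))"
        using tr(1) n_omega[OF leq_in1[OF tr(1)]] names_check by blast
    qed
  next
    fix x q
    assume x: "x \<in> names P" and *: "dense q (\<lambda>r. \<exists>n\<in>names P. fmem r n (check P omega) \<and>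
          dense r (\<lambda>s. \<exists>V\<in>names P. fmem s (opair_name n V) g \<and> fmem s x V))"
    \<comment> \<open>For the converse, the selected sets stay inside \<open>X\<close> because they
      are open.\<close>
    have step: "fmem s x (check P X)" if "fmem s (opair_name n V) g" "fmem s x V" for s n V
    proof -
      have "dense s (\<lambda>r. fmem r x (check P X))"
        using entry[OF that(1)]
      proof (rule dense_mono)
        fix r assume r: "r \<preceq> s" "\<exists>m. \<exists>a\<in>A m. r \<preceq> a \<and> feq r n (?n m) \<and> feq r V (U m a)"
        then obtain m a where a: "a \<in> A m" "r \<preceq> a" "feq r V (U m a)"
          by blast
        have aa: "a \<preceq> a"
          using leq_refl[OF AP(2)[OF a(1)]] .
        have "forces_cover a (C m a) (check P X) (check P \<tau>)"
          using f(3) good[OF a(1)] names_check unfolding forces_covers_def good_def by blast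
        then have "forces_open a (U m a) (check P X) (check P \<tau>)"
          using good[OF a(1)] aa unfolding forces_cover_def good_def by blast
        moreover have "fmem r x (U m a)"
          using fmem_cong2[OF a(3) fmem_mono[OF that(2) r(1)]] .
        ultimately show "fmem r x (check P X)"
          using x a(2) unfolding forces_open_def by blast
      qed
      then show ?thesis
        by (rule fmem_dense)
    qed
    have "dense q (\<lambda>s. fmem s x (check P X))"
      using *
    proof (rule dense_bind)
      fix r assume "\<exists>n\<in>names P. fmem r n (check P omega) \<and>
          dense r (\<lambda>s. \<exists>V\<in>names P. fmem s (opair_name n V) g \<and> fmem s x V)"
      then obtain n where "dense r (\<lambda>s. \<exists>V\<in>names P. fmem s (opair_name n V) g \<and> fmem s x V)"
        by blast
      then show "dense r (\<lambda>s. fmem s x (check P X))"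
        by (rule dense_mono) (use step in blast)
    qed
    then show "fmem q x (check P X)"
      by (rule fmem_dense)
  qed
  ultimately show ?thesis
    using g by blast
qed

end

section \<open>Strongly generic conditions\<close>

text \<open>Unboundedness: add \<open>a\<close> and close off under the countably many functions in
  \<omega> stages. Unions of chains inherit closure, since every element appears at some
  stage.\<close>

lemma club_closed_under:
  assumes "countable F" and F: "\<And>h x. h \<in> F \<Longrightarrow> x \<in> A \<Longrightarrow> h x \<in> A" and a: "a \<in> A"
  shows "club A {M \<in> ctbl_subsets A. a \<in> M \<and> (\<forall>h\<in>F. h ` M \<subseteq> M)}"
  unfolding club_def
proof (intro conjI ballI allI impI)
  fix x assume x: "x \<in> ctbl_subsets A"
  define c where "c = rec_nat (insert a x) (\<lambda>_ y. y \<union> (\<Union>h\<in>F. h ` y))"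
  have c: "c 0 = insert a x" "c (Suc n) = c n \<union> (\<Union>h\<in>F. h ` c n)" for n
    by (simp_all add: c_def)
  have "c n \<subseteq> A \<and> countable (c n)" for n
  proof (induction n)
    case 0
    show ?case
      using x a by (auto simp: c ctbl_subsets_def)
  next
    case (Suc n)
    then show ?case
      using F assms(1) by (auto simp: c intro!: countable_UN)
  qed
  then have sub: "(\<Union>n. c n) \<subseteq> A" "countable (\<Union>n. c n)"
    by (blast, auto)
  have "x \<subseteq> (\<Union>n. c n)" "a \<in> (\<Union>n. c n)"
    using c(1) by blast+
  moreover from this have "infinite (\<Union>n. c n)"
    using x infinite_super unfolding ctbl_subsets_def by blast
  moreover have "h ` (\<Union>n. c n) \<subseteq> (\<Union>n. c n)" if "h \<in> F" for h
    using c(2) that by blast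
  ultimately show "\<exists>y\<in>{M \<in> ctbl_subsets A. a \<in> M \<and> (\<forall>h\<in>F. h ` M \<subseteq> M)}. x \<subseteq> y"
    using sub by (intro bexI[of _ "\<Union>n. c n"]) (auto simp: ctbl_subsets_def)
next
  fix f :: "nat \<Rightarrow> 'a set"
  assume f: "incseq f \<and> range f \<subseteq> {M \<in> ctbl_subsets A. a \<in> M \<and> (\<forall>h\<in>F. h ` M \<subseteq> M)}"
  then have "f n \<in> {M \<in> ctbl_subsets A. a \<in> M \<and> (\<forall>h\<in>F. h ` M \<subseteq> M)}" for n
    by blast
  then have *: "f n \<subseteq> A" "countable (f n)" "infinite (f n)" "a \<in> f n" "h \<in> F \<Longrightarrow> h ` f n \<subseteq> f n"
    for n h
    by (simp_all add: ctbl_subsets_def)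
  have "infinite (\<Union>n. f n)"
    using infinite_super[OF _ *(3)[of 0]] by blast
  moreover have "h ` (\<Union>n. f n) \<subseteq> (\<Union>n. f n)" if "h \<in> F" for h
    using *(5)[OF that] by blast
  moreover have "(\<Union>n. f n) \<subseteq> A" "a \<in> (\<Union>n. f n)"
    using *(1,4) by blast+
  ultimately show "(\<Union>n. f n) \<in> {M \<in> ctbl_subsets A. a \<in> M \<and> (\<forall>h\<in>F. h ` M \<subseteq> M)}"
    using *(2) by (simp add: ctbl_subsets_def)
qed blast

lemma openin_topology_of:
  "is_space X \<tau> \<Longrightarrow> openin (topology_of \<tau>) U \<longleftrightarrow> U \<in> elts ` elts \<tau>"
  by (simp add: is_space_def topology_of_def topology_inverse')

lemma topspace_topology_of: "is_space X \<tau> \<Longrightarrow> topspace (topology_of \<tau>) = elts X"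
proof -
  assume space: "is_space X \<tau>"
  then have "{U. openin (topology_of \<tau>) U} = elts ` elts \<tau>"
    by (simp add: openin_topology_of)
  then show ?thesis
    using space by (simp add: topspace_def is_space_def)
qed

text \<open>An element \<open>z\<close> of \<open>x\<close> lies three membership steps below the
  pair, so its transitive closure is part of that of the pair and has no larger cardinality. This
  puts the conditions into the set on which stationarity is assumed.\<close>

lemma elts_subset_H:
  assumes "pair x y \<in> H \<theta>"
  shows "elts x \<subseteq> H \<theta>"
proof
  fix z assume z: "z \<in> elts x"
  let ?r = "{(a, b). a \<in> elts b}"
  have "(z, x) \<in> ?r" "(x, vset {x}) \<in> ?r" "(vset {x}, pair x y) \<in> ?r"
    using z by (simp_all add: pair_def)
  then have "(z, pair x y) \<in> ?r\<^sup>+"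
    by (intro trancl_into_trancl[OF trancl_into_trancl[OF r_into_trancl]])
  then have "trcl z \<subseteq> trcl (pair x y)"
    unfolding trcl_def by (auto elim: trancl_trans)
  from ordLeq_ordLess_trans[OF card_of_mono1[OF this]] show "z \<in> H \<theta>"
    using assms by (simp add: H_def)
qed

section \<open>From strong genericity to the forced Rothberger property\<close>

context forcing
begin

text \<open>Each condition \<open>r\<close> and each \<open>k\<close> come with a selection \<open>b r k\<close> from the covers with indices
  \<open>prod_encode (k, m)\<close>, whose values are made possible by conditions \<open>s r k m\<close> below \<open>r\<close>. In a
  model closed under \<open>s\<close> and with its conditions enumerated as \<open>r\<^sub>0, r\<^sub>1, \<dots>\<close>, the selections
  \<open>b r\<^sub>k k\<close> combine into one sequence, since they use disjoint sets of indices. That sequence need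
  not belong to the model.\<close>

lemma strongly_generic_selection:
  fixes R :: "nat \<Rightarrow> 'v \<Rightarrow> 'v \<Rightarrow> bool"
  assumes stat: "stationary A {M. countable M \<and> \<Phi> M \<and> strongly_proper_for P le M}"
    and PA: "elts P \<subseteq> A" and p0: "p0 \<in> elts P"
    and space: "is_space X \<tau>" and roth: "rothberger (topology_of \<tau>)"
    and mono: "\<And>n B q r. R n B q \<Longrightarrow> r \<preceq> q \<Longrightarrow> R n B r"
    and cover: "\<And>n q x. q \<preceq> p0 \<Longrightarrow> x \<in> elts X \<Longrightarrow>
      \<exists>r. r \<preceq> q \<and> (\<exists>B\<in>elts \<tau>. x \<in> elts B \<and> R n B r)"
  shows "\<exists>p B. p \<preceq> p0 \<and> (\<forall>q x. q \<preceq> p \<longrightarrow> x \<in> elts X \<longrightarrow>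
      (\<exists>n. x \<in> elts (B n) \<and> (\<exists>r. r \<preceq> q \<and> R n (B n) r)))"
proof -
  have "\<exists>b s. (\<forall>m. s m \<preceq> r \<and> R (prod_encode (k, m)) (b m) (s m)) \<and> elts X = (\<Union>m. elts (b m))"
    if r: "r \<preceq> p0" for r k
  proof -
    \<comment> \<open>By \<open>cover\<close> at \<open>r\<close> itself each point lies in one of
      these sets, so every \<open>\<U> m\<close> is an open cover in the ground model.\<close>
    define \<U> where "\<U> m = {elts B | B. B \<in> elts \<tau> \<and> (\<exists>s. s \<preceq> r \<and> R (prod_encode (k, m)) B s)}" for m
    have "\<Union> (\<U> m) = elts X" for m
    proof
      have "elts B \<subseteq> elts X" if "B \<in> elts \<tau>" for B
        using conjunct2[OF space[unfolded is_space_def]] that by auto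
      then show "\<Union> (\<U> m) \<subseteq> elts X"
        unfolding \<U>_def by auto
      show "elts X \<subseteq> \<Union> (\<U> m)"
      proof
        fix x assume "x \<in> elts X"
        then obtain s B where "s \<preceq> r" "B \<in> elts \<tau>" "x \<in> elts B" "R (prod_encode (k, m)) B s"
          using cover[OF r] by meson
        then show "x \<in> \<Union> (\<U> m)"
          unfolding \<U>_def by auto
      qed
    qed
    moreover have "\<forall>U\<in>\<U> m. openin (topology_of \<tau>) U" for m
      by (auto simp: \<U>_def openin_topology_of[OF space])
    ultimately obtain U where U: "\<And>m. U m \<in> \<U> m" "elts X = (\<Union>m. U m)"
      using roth[unfolded rothberger_def topspace_topology_of[OF space], rule_format, of \<U>]
      by blast
    then have "\<forall>m. \<exists>B s. U m = elts B \<and> s \<preceq> r \<and> R (prod_encode (k, m)) B s"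
      unfolding \<U>_def mem_Collect_eq by metis
    then obtain b s where "\<And>m. U m = elts (b m) \<and> s m \<preceq> r \<and> R (prod_encode (k, m)) (b m) (s m)"
      by metis
    then show ?thesis
      using U(2) by auto
  qed
  then have "\<forall>r k. \<exists>b s. r \<preceq> p0 \<longrightarrow>
      (\<forall>m. s m \<preceq> r \<and> R (prod_encode (k, m)) (b m) (s m)) \<and> elts X = (\<Union>m. elts (b m))"
    by blast
  then obtain b s where "\<forall>r k. r \<preceq> p0 \<longrightarrow> (\<forall>m. s r k m \<preceq> r \<and>
      R (prod_encode (k, m)) (b r k m) (s r k m)) \<and> elts X = (\<Union>m. elts (b r k m))"
    unfolding choice_iff by blast
  then have s: "\<And>r k m. r \<preceq> p0 \<Longrightarrow> s r k m \<preceq> r"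
      "\<And>r k m. r \<preceq> p0 \<Longrightarrow> R (prod_encode (k, m)) (b r k m) (s r k m)"
    and b: "\<And>r k. r \<preceq> p0 \<Longrightarrow> elts X = (\<Union>m. elts (b r k m))"
    by blast+
  \<comment> \<open>\<open>S\<close> and \<open>W\<close> are extended by the identity, so that they
    map \<open>A\<close> into itself.\<close>
  define S where "S k m r = (if r \<preceq> p0 then s r k m else r)" for k m r
  \<comment> \<open>A residue in \<open>M\<close> need not lie below \<open>p0\<close>, where the
    selections are available. \<open>W\<close> moves a condition compatible with \<open>p0\<close>
    there, and a set closed under \<open>W\<close> contains the result.\<close>
  define W where "W r = (if compat P le r p0 then SOME t. t \<preceq> r \<and> t \<preceq> p0 else r)" for r
  have W: "W r \<preceq> r" "W r \<preceq> p0" if "compat P le r p0" for r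
  proof -
    have "\<exists>t. t \<preceq> r \<and> t \<preceq> p0"
      using that unfolding compat_def by blast
    then have "W r \<preceq> r \<and> W r \<preceq> p0"
      unfolding W_def using that by (auto intro: someI2_ex)
    then show "W r \<preceq> r" "W r \<preceq> p0"
      by blast+
  qed
  define F where "F = insert W (range (\<lambda>(k, m). S k m))"
  have "club A {M \<in> ctbl_subsets A. p0 \<in> M \<and> (\<forall>h\<in>F. h ` M \<subseteq> M)}"
  proof (rule club_closed_under)
    show "countable F" "p0 \<in> A"
      using PA p0 by (auto simp: F_def)
    have "S k m x \<in> A" if "x \<in> A" for k m x
      using that leq_in1[OF s(1)] PA by (auto simp: S_def)
    moreover have "W x \<in> A" if "x \<in> A" for x
      using that W(1) leq_in1 PA by (cases "compat P le x p0") (auto simp: W_def)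
    ultimately show "h x \<in> A" if "h \<in> F" "x \<in> A" for h x
      using that unfolding F_def by auto
  qed
  then obtain M where M: "countable M" "strongly_proper_for P le M" "p0 \<in> M" "\<forall>h\<in>F. h ` M \<subseteq> M"
    using stat unfolding stationary_def by blast
  have SM: "s r k m \<in> M" if "r \<in> M" "r \<preceq> p0" for r k m
  proof -
    have "S k m ` M \<subseteq> M"
      using M(4) unfolding F_def by auto
    then show ?thesis
      using that unfolding S_def by force
  qed
  have WM: "W r \<in> M" if "r \<in> M" for r
    using M(4) that unfolding F_def by blast
  obtain p where p: "p \<preceq> p0" "strongly_generic P le M p"
    using M(2,3) p0 unfolding strongly_proper_for_def by blast
  let ?Q = "{r \<in> M. r \<preceq> p0}"
  \<comment> \<open>The \<open>k\<close>-th condition in an enumeration of \<open>?Q\<close>, where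
    repetitions do no harm, supplies the values at the indices
    \<open>prod_encode (k, m)\<close>.\<close>
  define B where "B n = (case prod_decode n of (k, m) \<Rightarrow> b (from_nat_into ?Q k) k m)" for n
  have "\<exists>n. x \<in> elts (B n) \<and> (\<exists>t. t \<preceq> q \<and> R n (B n) t)" if q: "q \<preceq> p" and x: "x \<in> elts X" for q x
  proof -
    obtain r where r: "r \<in> M" "r \<in> elts P"
      and res: "\<And>t. t \<in> M \<Longrightarrow> t \<in> elts P \<Longrightarrow> t \<preceq> r \<Longrightarrow> compat P le t q"
      using p(2) q leq_in1[OF q] unfolding strongly_generic_def residue_def by blast
    \<comment> \<open>The residue property at \<open>r\<close> itself gives a common extension of
      \<open>r\<close> and \<open>q\<close>, which lies below \<open>p0\<close> because
      \<open>q\<close> does.\<close>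
    have "compat P le r p0"
      using res[OF r leq_refl[OF r(2)]] leq_trans[OF _ leq_trans[OF q p(1)]] unfolding compat_def by blast
    note W = W[OF this]
    then have "W r \<in> ?Q"
      using WM r(1) by blast
    then obtain k where k: "from_nat_into ?Q k = W r"
      using from_nat_into_surj[of ?Q "W r"] M(1) by (auto intro: countable_subset)
    obtain m where m: "x \<in> elts (b (W r) k m)"
      using b[OF W(2)] x by blast
    let ?s = "s (W r) k m"
    \<comment> \<open>\<open>?s\<close> is in \<open>M\<close> and below \<open>W r\<close>, hence
      below the residue \<open>r\<close>, so it is compatible with \<open>q\<close>. A common
      extension then inherits \<open>R\<close> from \<open>?s\<close>.\<close>
    have "compat P le ?s q"
      using res[OF SM[OF WM[OF r(1)] W(2)]] s(1)[OF W(2)] leq_in1 leq_trans[OF _ W(1)] by blast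
    then obtain t where "t \<preceq> ?s" "t \<preceq> q"
      unfolding compat_def by blast
    moreover from this have "R (prod_encode (k, m)) (b (W r) k m) t"
      using mono s(2)[OF W(2)] by blast
    moreover have "B (prod_encode (k, m)) = b (W r) k m"
      by (simp add: B_def k)
    ultimately show ?thesis
      using m by metis
  qed
  then show ?thesis
    using p(1) by blast
qed

lemma forces_rothbergerI:
  assumes stat: "stationary A {M. countable M \<and> \<Phi> M \<and> strongly_proper_for P le M}"
    and PA: "elts P \<subseteq> A"
    and space: "is_space X \<tau>" and roth: "rothberger (topology_of \<tau>)"
  shows "forces_rothberger P le X \<tau>"
  unfolding forces_rothberger_def
proof
  \<comment> \<open>Empty families cover the empty space, but nothing can be selected from them; so
    a Rothberger space in this sense has a point.\<close>
  have X: "elts X \<noteq> {}"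
  proof
    assume "elts X = {}"
    then have "\<exists>U :: nat \<Rightarrow> 'v set. \<forall>n. U n \<in> {}"
      using roth[unfolded rothberger_def, rule_format, of "\<lambda>_. {}"]
      by (simp add: topspace_topology_of[OF space])
    then show False
      by simp
  qed
  fix p
  let ?e = "(\<lambda>_. check P omega)(0 := check P X, 1 := check P \<tau>)"
  have "dense q (\<lambda>r. \<exists>g\<in>names P. forces_function r g (check P omega) \<and> forces_selection r f g \<and>
         forces_range_covers r g (check P X) (check P omega))"
    if f: "f \<in> names P" "forces_function q f (check P omega)"
      "forces_covers q f (check P X) (check P \<tau>)" for f q
  proof (rule denseI)
    fix r assume r: "r \<preceq> q"
    \<comment> \<open>Each \<open>r\<close> takes the role of \<open>p0\<close>, so that conditions
      with a selector become dense below \<open>q\<close>.\<close>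
    have "\<exists>s B. s \<preceq> r \<and> (\<forall>t x. t \<preceq> s \<longrightarrow> x \<in> elts X \<longrightarrow>
        (\<exists>n. x \<in> elts (B n) \<and> (\<exists>u. u \<preceq> t \<and> forces_refines f n (B n) u)))"
    proof (rule strongly_generic_selection[OF stat PA leq_in1[OF r] space roth])
      show "forces_refines f n B t" if "forces_refines f n B s" "t \<preceq> s" for n B s t
        using that by (rule forces_refines_mono)
      show "\<exists>t. t \<preceq> s \<and> (\<exists>B\<in>elts \<tau>. x \<in> elts B \<and> forces_refines f n B t)"
        if "s \<preceq> r" "x \<in> elts X" for n s x
        using forces_refines_dense[OF f(2,3) leq_trans[OF that(1) r] that(2)] .
    qed
    then obtain s B where s: "s \<preceq> r" and B: "\<And>t x. t \<preceq> s \<Longrightarrow> x \<in> elts X \<Longrightarrow>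
        \<exists>n. x \<in> elts (B n) \<and> (\<exists>u. u \<preceq> t \<and> forces_refines f n (B n) u)"
      by blast
    have sq: "s \<preceq> q"
      using leq_trans[OF s r] .
    have "forces_function s f (check P omega)"
      using f(2) leq_trans[OF _ sq] unfolding forces_function_def by blast
    moreover have "forces_covers s f (check P X) (check P \<tau>)"
      using f(3) leq_trans[OF _ sq] unfolding forces_covers_def by blast
    ultimately show "\<exists>s. s \<preceq> r \<and> (\<exists>g\<in>names P. forces_function s g (check P omega) \<and>
        forces_selection s f g \<and> forces_range_covers s g (check P X) (check P omega))"
      using s selection_name[OF f(1) _ _ X B] by blast
  qed
  then show "forces P le (rothberger_fm 0 1 2) ?e p"
    by (subst forces_rothberger_fm) (simp_all add: names_check)
qed

end

theorem theorem5p6: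
  fixes X \<tau> P le :: "'v::set_universe" and \<theta> :: "'k rel"
  assumes "Card_order \<theta>" and "regularCard \<theta>" and "large_enough \<theta> X \<tau> P"
    and "is_space X \<tau>" and "pair X \<tau> \<in> H \<theta>" and "rothberger (topology_of \<tau>)"
    and "is_poset P le" and "pair P le \<in> H \<theta>"
    and "stationary (H \<theta>)
           {M. countable M \<and> elementary_submodel M (H \<theta>) \<and> pair P le \<in> M \<and>
               strongly_proper_for P le M}"
  shows "forces_rothberger P le X \<tau>"
proof -
  interpret forcing P le
    using assms(7) by unfold_locales
  show ?thesis
    \<comment> \<open>The parameter \<Phi> takes up the clauses on elementarity and on the poset
      belonging to the model.\<close>
    by (rule forces_rothbergerI[OF _ elts_subset_H[OF assms(8)] assms(4,6),
          of "\<lambda>M. elementary_submodel M (H \<theta>) \<and> pair P le \<in> M"])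
      (use assms(9) in \<open>simp add: conj_assoc\<close>)
qed

end
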